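(* Let $n\ge 1$ be an integer. Then there exist constants $\rho>0$, $C>0$ and $Q_0>1$, depending on $n$ only, such that for every real $Q\ge Q_0$ one has $$\#\mathcal{R}_{n,\rho}(Q,w)\ \ge\ C\,Q^{2n+2-2w}\qquad\text{if } 0\le w\le \tfrac{n+1}{2},$$ and $$\#\mathcal{R}_{n,\rho}(Q,w)\ \ge\ C\,Q^{2n+2-2w-\frac{2}{n}(2w-n-1)}\qquad\text{if } \tfrac{n+1}{2}\le w\le n.$$
   Context: For a polynomial $P=a_nx^n+\dots+a_0\in\mathbb{Z}[x]$ of degree $n$, $H(P)=\max_{0\le i\le n}|a_i|$ is its (naive) height, and for real $Q>1$ $$\mathcal{P}_n(Q)=\{P\in\mathbb{Z}[x]:\deg P=n,\ H(P)\le Q\}$$ (degree exactly $n$). For $P_1=a_nx^n+\dots+a_0$ and $P_2=b_nx^n+\dots+b_0$ of degree $n$ with roots $\alpha_1,\dots,\alpha_n\in\mathbb{C}$ and $\beta_1,\dots,\beta_n\in\mathbb{C}$ respectively (with multiplicity), the resultant is $R(P_1,P_2)=a_n^nb_n^n\prod_{1\le i,j\le n}(\alpha_i-\beta_j)$. For $\rho>0$ and real $w$ define $$\mathcal{R}_{n,\rho}(Q,w)=\{(P_1,P_2)\in\mathcal{P}_n(Q)^2:0<|R(P_1,P_2)|\le\rho\,Q^{2n-2w}\}.$$ *)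

theory Defs
  imports
    Complex_Main
    "HOL-Computational_Algebra.Fundamental_Theorem_Algebra"
    "Subresultants.Subresultant"
begin

definition poly_height :: "int poly \<Rightarrow> int" where
  "poly_height P = Max ((\<lambda>i. \<bar>coeff P i\<bar>) ` {..degree P})"

definition bounded_polys :: "nat \<Rightarrow> real \<Rightarrow> int poly set" where
  "bounded_polys n Q = {P. degree P = n \<and> real_of_int (poly_height P) \<le> Q}"

definition resultant_pairs :: "nat \<Rightarrow> real \<Rightarrow> real \<Rightarrow> real \<Rightarrow> (int poly \<times> int poly) set" where
  "resultant_pairs n \<rho> Q w =
     {(P1, P2) \<in> bounded_polys n Q \<times> bounded_polys n Q.
        0 < \<bar>resultant P1 P2\<bar> \<and>
        real_of_int \<bar>resultant P1 P2\<bar> \<le> \<rho> * Q powr (2 * real n - 2 * w)}"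

text \<open>
  The sets above are finite, so \<^const>\<open>card\<close> really counts their elements.
\<close>

lemma finite_bounded_polys: "finite (bounded_polys n Q)"
proof (rule finite_subset)
  let ?B = "{- \<lfloor>Q\<rfloor>..\<lfloor>Q\<rfloor>}"
  let ?L = "{xs :: int list. set xs \<subseteq> ?B \<and> length xs = Suc n}"
  show "bounded_polys n Q \<subseteq> Poly ` ?L"
  proof
    fix P assume "P \<in> bounded_polys n Q"
    hence deg: "degree P = n" and h: "real_of_int (poly_height P) \<le> Q"
      by (auto simp: bounded_polys_def)
    let ?xs = "map (coeff P) [0..<Suc n]"
    have "\<bar>coeff P i\<bar> \<le> \<lfloor>Q\<rfloor>" if "i \<le> n" for i
    proof -
      have "\<bar>coeff P i\<bar> \<le> poly_height P"
        unfolding poly_height_def using that deg by (intro Max_ge) auto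
      thus ?thesis using h by linarith
    qed
    hence "\<And>i. i \<le> n \<Longrightarrow> coeff P i \<in> ?B"
      by (metis abs_le_iff atLeastAtMost_iff minus_le_iff)
    hence "?xs \<in> ?L" by (auto simp: less_Suc_eq_le simp del: upt_Suc)
    moreover have "P = Poly ?xs"
      using deg by (intro poly_eqI)
        (auto simp: nth_default_def coeff_eq_0 simp del: upt_Suc)
    ultimately show "P \<in> Poly ` ?L" by blast
  qed
  show "finite (Poly ` ?L)"
    by (intro finite_imageI finite_lists_length_eq) auto
qed

lemma finite_resultant_pairs: "finite (resultant_pairs n \<rho> Q w)"
  unfolding resultant_pairs_def
  by (rule finite_subset[OF _ finite_cartesian_product
        [OF finite_bounded_polys[of n Q] finite_bounded_polys[of n Q]]]) auto

text \<open>
  The library defines \<^const>\<open>resultant\<close> as the determinant of the Sylvester matrix. The lemma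
  \<open>resultant_conv_roots\<close> below confirms that for integer polynomials this is the product of the
  differences of the complex roots (with multiplicity), scaled by powers of the leading
  coefficients, including the sign.
\<close>

lemma poly_conv_proots:
  fixes f :: "complex poly"
  assumes "f \<noteq> 0"
  shows "poly f x = lead_coeff f * (\<Prod>\<alpha>\<in>#proots f. x - \<alpha>)"
    and "size (proots f) = degree f"
proof -
  obtain A where A: "size A = degree f" "f = Polynomial.smult (lead_coeff f) (\<Prod>x\<in>#A. [:-x, 1:])"
    using alg_closed_imp_factorization[OF assms] by blast
  have nz: "lead_coeff f \<noteq> 0" using assms by simp
  have "proots f = proots (\<Prod>x\<in>#A. [:-x, 1:])"
    using A(2) nz by (metis proots_smult)
  also have "\<dots> = A"
  proof (induction A)
    case (add a A)
    have "(\<Prod>x\<in>#A. [:-x, 1:]) \<noteq> 0"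
      by (induction A) (simp_all del: mult_pCons_left mult_pCons_right)
    hence "proots ([:-a, 1:] * (\<Prod>x\<in>#A. [:-x, 1:])) =
        proots [:-a, 1:] + proots (\<Prod>x\<in>#A. [:-x, 1:])"
      by (intro proots_mult) auto
    also have "proots [:-a, 1:] = {#a#}"
      using proots_linear_factor[of "-a"] by (simp only: minus_minus)
    finally show ?case
      using add.IH by (simp del: mult_pCons_left mult_pCons_right)
  qed simp
  finally have pA: "proots f = A" .
  have "poly (\<Prod>x\<in>#A. [:-x, 1:]) x = (\<Prod>\<alpha>\<in>#A. x - \<alpha>)"
    by (induction A) (auto simp: algebra_simps)
  thus "poly f x = lead_coeff f * (\<Prod>\<alpha>\<in>#proots f. x - \<alpha>)"
    using pA A(2) by (metis poly_smult)
  show "size (proots f) = degree f" using pA A by simp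
qed

lemma roots_product_right:
  fixes f g :: "complex poly"
  assumes "f \<noteq> 0"
  shows "lead_coeff f ^ size B * (\<Prod>\<beta>\<in>#B. \<Prod>\<alpha>\<in>#proots f. \<beta> - \<alpha>) = (\<Prod>\<beta>\<in>#B. poly f \<beta>)"
  by (induction B) (auto simp: poly_conv_proots(1)[OF assms])

lemma prod_mset_diff_swap:
  fixes A B :: "complex multiset"
  shows "(\<Prod>\<alpha>\<in>#A. \<Prod>\<beta>\<in>#B. \<alpha> - \<beta>) =
    (- 1) ^ (size A * size B) * (\<Prod>\<beta>\<in>#B. \<Prod>\<alpha>\<in>#A. \<beta> - \<alpha>)"
proof (induction A)
  case (add a A)
  have "(\<Prod>\<beta>\<in>#B. a - \<beta>) = (-1) ^ size B * (\<Prod>\<beta>\<in>#B. \<beta> - a)"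
    by (induction B) (auto simp: algebra_simps)
  thus ?case using add.IH by (simp add: prod_mset.distrib power_add mult_ac)
qed simp

definition roots_resultant :: "complex poly \<Rightarrow> complex poly \<Rightarrow> complex" where
  "roots_resultant f g = lead_coeff f ^ degree g * lead_coeff g ^ degree f *
     (\<Prod>\<alpha>\<in>#proots f. \<Prod>\<beta>\<in>#proots g. \<alpha> - \<beta>)"

lemma roots_resultant_swap:
  assumes "f \<noteq> 0" "g \<noteq> 0"
  shows "roots_resultant f g = (-1) ^ (degree f * degree g) * roots_resultant g f"
  unfolding roots_resultant_def prod_mset_diff_swap[of "proots f"]
  using poly_conv_proots(2)[OF assms(1)] poly_conv_proots(2)[OF assms(2)]
  by (simp add: mult_ac)

lemma roots_resultant_eval:
  assumes "f \<noteq> 0" "g \<noteq> 0"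
  shows "roots_resultant f g =
    (-1) ^ (degree f * degree g) * lead_coeff g ^ degree f * (\<Prod>\<beta>\<in>#proots g. poly f \<beta>)"
  unfolding roots_resultant_def prod_mset_diff_swap[of "proots f"]
    roots_product_right[OF assms(1), symmetric]
  using poly_conv_proots(2)[OF assms(1)] poly_conv_proots(2)[OF assms(2)]
  by (simp add: mult_ac)

lemma resultant_conv_roots_complex:
  fixes f g :: "complex poly"
  assumes "f \<noteq> 0" "g \<noteq> 0"
  shows "resultant f g = roots_resultant f g"
  using assms
proof (induction "degree g" arbitrary: f g rule: less_induct)
  case less
  note f0 = \<open>f \<noteq> 0\<close> and g0 = \<open>g \<noteq> 0\<close>
  let ?m = "degree f" and ?n = "degree g"
  consider "?n = 0" | "?m < ?n" | "0 < ?n" "?n \<le> ?m" by linarith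
  thus ?case
  proof cases
    case 1
    then obtain c where g: "g = [:c:]" by (metis degree_eq_zeroE)
    thus ?thesis by (simp add: roots_resultant_def)
  next
    case 2
    show ?thesis
      unfolding resultant_swap[of f g] roots_resultant_swap[OF f0 g0]
      using less.hyps[OF 2 g0 f0] by simp
  next
    case 3
    define h where "h = f mod g"
    define b where "b = - (f div g)"
    have eq: "f + b * g = h"
      unfolding h_def b_def by (simp add: minus_div_mult_eq_mod[symmetric])
    have choice: "degree g > degree h \<or> h = 0 \<and> f \<noteq> 0 \<and> g \<noteq> 0"
      using degree_mod_less'[of g f] f0 g0 h_def by auto
    have root: "poly f \<beta> = poly h \<beta>" if "\<beta> \<in># proots g" for \<beta>
    proof -
      have "poly g \<beta> = 0" using that g0 by simp
      thus ?thesis unfolding eq[symmetric] by simp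
    qed
    have prod: "(\<Prod>\<beta>\<in>#proots g. poly f \<beta>) = (\<Prod>\<beta>\<in>#proots g. poly h \<beta>)"
      by (intro arg_cong[of _ _ prod_mset] image_mset_cong root)
    have size: "size (proots g) = ?n" by (rule poly_conv_proots(2)[OF g0])
    show ?thesis
    proof (cases "degree h = 0")
      case True
      then obtain c where h: "h = [:c:]" by (metis degree_eq_zeroE)
      have "subresultant 0 f g =
        Polynomial.smult ((-1) ^ (?m * ?n) * lead_coeff g ^ ?m * c ^ (?n - 1)) [:c:]"
        using BT_eq_19[OF eq 3(2) choice _ 3(1)] True h by simp
      hence "resultant f g = (-1) ^ (?m * ?n) * lead_coeff g ^ ?m * (c ^ (?n - 1) * c)"
        unfolding subresultant_resultant by simp
      also have "c ^ (?n - 1) * c = c ^ ?n" using 3(1) by (metis power_minus_mult)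
      also have "c ^ ?n = (\<Prod>\<beta>\<in>#proots g. poly h \<beta>)"
        unfolding h by (simp add: size image_mset_const_eq)
      finally show ?thesis unfolding roots_resultant_eval[OF f0 g0] prod .
    next
      case False
      hence h0: "h \<noteq> 0" by auto
      have lt: "degree h < degree g" using choice h0 by auto
      have "subresultant 0 f g =
        Polynomial.smult ((-1) ^ (?m * ?n) * lead_coeff g ^ (?m - degree h)) (subresultant 0 g h)"
        using BT_lemma_1_12[OF eq 3(2) choice, of 0] False by simp
      hence "resultant f g =
          (-1) ^ (?m * ?n) * lead_coeff g ^ (?m - degree h) * resultant g h"
        unfolding subresultant_resultant by simp
      also have "resultant g h = roots_resultant g h" by (rule less.hyps[OF lt g0 h0])
      also have "\<dots> = ((-1) ^ (?n * degree h) * (-1) ^ (?n * degree h)) *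
          lead_coeff g ^ degree h * (\<Prod>\<beta>\<in>#proots g. poly h \<beta>)"
        unfolding roots_resultant_swap[OF g0 h0] roots_resultant_eval[OF h0 g0]
        by (simp add: mult.commute[of "degree h"])
      also have "(-1) ^ (?n * degree h) * (-1) ^ (?n * degree h) = (1 :: complex)"
        by (simp flip: power_mult_distrib)
      also have "(-1) ^ (?m * ?n) * lead_coeff g ^ (?m - degree h) *
          (1 * lead_coeff g ^ degree h * (\<Prod>\<beta>\<in>#proots g. poly h \<beta>)) =
          (-1) ^ (?m * ?n) * (lead_coeff g ^ (?m - degree h) * lead_coeff g ^ degree h) *
          (\<Prod>\<beta>\<in>#proots g. poly h \<beta>)"
        by simp
      also have "lead_coeff g ^ (?m - degree h) * lead_coeff g ^ degree h = lead_coeff g ^ ?m"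
        using lt 3(2) by (simp flip: power_add)
      finally show ?thesis unfolding roots_resultant_eval[OF f0 g0] prod .
    qed
  qed
qed

lemma resultant_conv_roots:
  fixes P1 P2 :: "int poly"
  assumes "degree P1 = n" "degree P2 = n" "P1 \<noteq> 0" "P2 \<noteq> 0"
  shows "complex_of_int (resultant P1 P2) =
    of_int (lead_coeff P1) ^ n * of_int (lead_coeff P2) ^ n *
    (\<Prod>\<alpha>\<in>#proots (map_poly complex_of_int P1).
       \<Prod>\<beta>\<in>#proots (map_poly complex_of_int P2). \<alpha> - \<beta>)"
proof -
  have "complex_of_int (resultant P1 P2) =
      resultant (map_poly complex_of_int P1) (map_poly complex_of_int P2)"
    by (rule of_int_hom.resultant_hom[symmetric])
  also have "\<dots> = roots_resultant (map_poly complex_of_int P1) (map_poly complex_of_int P2)"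
    using assms by (intro resultant_conv_roots_complex) auto
  finally show ?thesis using assms by (simp add: roots_resultant_def)
qed

end

theory Submission
  imports Defs "Subresultants.Subresultant_Gcd" "HOL-Number_Theory.Cong"
begin

text \<open>
  Two mechanisms make a resultant small. The first is arithmetic: if \<open>F\<close> has a real root
  \<open>\<alpha>\<close> in a bounded interval and \<open>G\<close> is an integer polynomial with \<open>\<bar>G \<alpha>\<bar> \<le> \<delta>\<close>, then the resultant of
  \<open>F + G\<close> and \<open>F\<close> is, up to sign, \<open>lead_coeff F ^ n\<close> times the product of the values of \<open>G\<close> at the
  roots of \<open>F\<close>, so one of its factors is at most \<open>\<delta>\<close>. For coefficients of size \<open>M\<close> and
  \<open>\<delta> = M / L\<close> this gives a resultant of order \<open>M ^ (2 * n) / L\<close>. The pigeonhole principle supplies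
  about \<open>M ^ (n + 1) / L\<close> such \<open>G\<close> for every \<open>F\<close>, as long as \<open>L\<close> is at most a small multiple of
  \<open>M ^ (n + 1)\<close> (\<open>card_small_polys\<close>). Since there are of order \<open>M ^ (n + 1)\<close> suitable \<open>F\<close>, this
  yields \<open>M ^ (2 * n + 2) / L\<close> pairs, which is the claim for \<open>w \<le> (n + 1) / 2\<close> with \<open>M\<close> of order \<open>Q\<close>
  and \<open>L\<close> of order \<open>Q powr (2 * w)\<close>. The resultant must not vanish: \<open>F\<close> is taken to be primitive
  and Eisenstein at 2, hence irreducible, with a leading coefficient that exceeds the
  coefficients of \<open>G\<close>; a common factor would make \<open>G\<close> a nonzero integer multiple of \<open>F\<close>
  (\<open>resultant_perturbed_nonzero\<close>).

  The second mechanism is geometric. The substitution \<open>x \<mapsto> (a x + b) / (c x + d)\<close> of determinant 1,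
  cleared of denominators, preserves the resultant (\<open>resultant_moebius\<close>) and multiplies heights by
  at most a constant times \<open>T ^ n\<close> when the entries are of size \<open>T\<close>. It carries all roots into a cluster near \<open>- d / c\<close>,
  so the polynomials it produces have nearly a common multiple root. There are of order
  \<open>T\<^sup>2\<close> coprime pairs \<open>(c, d)\<close>, and if \<open>a / c\<close> stays away from the roots, then \<open>(c, d)\<close> can be read
  off from any root of the image (\<open>far_unimodular_unique\<close>). Thus the pairs coming from different
  substitutions are distinct and the count is multiplied by \<open>T\<^sup>2\<close>.

  Both mechanisms together give \<open>T\<^sup>2 M ^ (2 * n + 2) / L\<close> pairs of height of order \<open>M T ^ n\<close> and
  resultant of order \<open>M ^ (2 * n) / L\<close> (\<open>resultant_pairs_count\<close>). For \<open>w \<ge> (n + 1) / 2\<close> the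
  pigeonhole principle is used to its limit, \<open>L\<close> of order \<open>M ^ (n + 1)\<close>, and \<open>T = Q powr (d / 2)\<close>
  up to a constant with \<open>d = 2 (2 w - n - 1) / (n (n - 1))\<close>. This makes the resultant
  \<open>M ^ (n - 1)\<close>, that is \<open>Q powr (2 * n - 2 * w)\<close>, and the number of pairs
  \<open>T\<^sup>2 M ^ (n + 1)\<close>, that is \<open>Q\<close> to the required exponent.
\<close>

section \<open>Unimodular substitutions and the resultant\<close>

text \<open>
  This is \<open>(c x + d) ^ n * f ((a x + b) / (c x + d))\<close>, the action of the matrix with rows \<open>(a, b)\<close>
  and \<open>(c, d)\<close> on binary forms of degree \<open>n\<close>. The degree \<open>n\<close> is a parameter because the action is
  linear only for a fixed one.
\<close>

definition moebius ::
  "'a::comm_ring_1 \<Rightarrow> 'a \<Rightarrow> 'a \<Rightarrow> 'a \<Rightarrow> nat \<Rightarrow> 'a poly \<Rightarrow> 'a poly" where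
  "moebius a b c d n f =
     (\<Sum>i\<le>n. Polynomial.smult (coeff f i) ([:b, a:] ^ i * [:d, c:] ^ (n - i)))"

lemma moebius_of_int:
  "map_poly complex_of_int (moebius a b c d n f) =
     moebius (of_int a) (of_int b) (of_int c) (of_int d) n (map_poly of_int f)"
  by (simp add: moebius_def hom_distribs)

lemma poly_moebius:
  fixes f :: "'a::field poly"
  assumes "degree f \<le> n" "c * x + d \<noteq> 0"
  shows "poly (moebius a b c d n f) x = (c * x + d) ^ n * poly f ((a * x + b) / (c * x + d))"
proof -
  have "poly (moebius a b c d n f) x =
      (\<Sum>i\<le>n. coeff f i * ((a * x + b) ^ i * (c * x + d) ^ (n - i)))"
    by (simp add: moebius_def poly_sum algebra_simps)
  also have "\<dots> = (\<Sum>i\<le>n. (c * x + d) ^ n * (coeff f i * ((a * x + b) / (c * x + d)) ^ i))"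
    using assms(2) by (intro sum.cong) (auto simp: power_diff power_divide field_simps)
  also have "\<dots> = (c * x + d) ^ n * (\<Sum>i\<le>n. coeff f i * ((a * x + b) / (c * x + d)) ^ i)"
    by (simp add: sum_distrib_left)
  also have "(\<Sum>i\<le>n. coeff f i * ((a * x + b) / (c * x + d)) ^ i) =
      poly f ((a * x + b) / (c * x + d))"
    using assms(1) by (simp add: poly_altdef, intro sum.mono_neutral_right) (auto simp: coeff_eq_0)
  finally show ?thesis .
qed

lemma poly_eqI_off_line:
  fixes p q :: "'a::field_char_0 poly"
  assumes "c \<noteq> 0 \<or> d \<noteq> 0" "\<And>x. c * x + d \<noteq> 0 \<Longrightarrow> poly p x = poly q x"
  shows "p = q"
proof (rule ccontr)
  assume "p \<noteq> q"
  hence "finite {x. poly ((p - q) * [:d, c:]) x = 0}"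
    using assms(1) by (intro poly_roots_finite) (auto simp del: mult_pCons_right)
  moreover have "{x. poly ((p - q) * [:d, c:]) x = 0} = UNIV"
  proof -
    have "poly ((p - q) * [:d, c:]) x = 0" for x
      using assms(2)[of x] by (cases "c * x + d = 0") (simp_all add: mult.commute add.commute del: mult_pCons_right)
    thus ?thesis by auto
  qed
  ultimately show False using infinite_UNIV_char_0[where 'a = 'a] by metis
qed

lemma moebius_inverse:
  fixes z :: "'a::field"
  assumes "a * d - b * c = 1" "a - c * z \<noteq> 0"
  shows "c * ((d * z - b) / (a - c * z)) + d = 1 / (a - c * z)"
    and "a * ((d * z - b) / (a - c * z)) + b = z / (a - c * z)"
proof -
  have "c * (d * z - b) + d * (a - c * z) = a * d - b * c"
    and "a * (d * z - b) + b * (a - c * z) = (a * d - b * c) * z"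
    by (simp_all add: algebra_simps)
  hence num: "c * (d * z - b) + d * (a - c * z) = 1" "a * (d * z - b) + b * (a - c * z) = z"
    unfolding assms(1) by simp_all
  have "c * ((d * z - b) / (a - c * z)) + d = (c * (d * z - b) + d * (a - c * z)) / (a - c * z)"
    using assms(2) by (simp add: add_divide_distrib)
  thus "c * ((d * z - b) / (a - c * z)) + d = 1 / (a - c * z)" by (simp only: num)
  have "a * ((d * z - b) / (a - c * z)) + b = (a * (d * z - b) + b * (a - c * z)) / (a - c * z)"
    using assms(2) by (simp add: add_divide_distrib)
  thus "a * ((d * z - b) / (a - c * z)) + b = z / (a - c * z)" by (simp only: num)
qed

text \<open>
  Every \<open>z\<close> with \<open>a - c z \<noteq> 0\<close> is the image of a point where the denominator does not vanish, so the
  transform determines the values of the polynomial at all but at most one point.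
\<close>

lemma moebius_inject:
  fixes f g :: "'a::field_char_0 poly"
  assumes det: "a * d - b * c = 1" and deg: "degree f \<le> n" "degree g \<le> n"
    and eq: "moebius a b c d n f = moebius a b c d n g"
  shows "f = g"
proof (rule poly_eqI_off_line[of "-c" a])
  show "- c \<noteq> 0 \<or> a \<noteq> 0" using det by auto
  fix z assume "- c * z + a \<noteq> 0"
  hence z: "a - c * z \<noteq> 0" by simp
  let ?x = "(d * z - b) / (a - c * z)"
  note inv = moebius_inverse[OF det z]
  have nz: "c * ?x + d \<noteq> 0" and zz: "(a * ?x + b) / (c * ?x + d) = z"
    unfolding inv using z by auto
  have "(c * ?x + d) ^ n * poly f z = (c * ?x + d) ^ n * poly g z"
    using poly_moebius[OF deg(1) nz, of a b] poly_moebius[OF deg(2) nz, of a b]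
    unfolding eq zz by (simp only:)
  thus "poly f z = poly g z" using nz by simp
qed

lemma moebius_factor:
  fixes f :: "complex poly"
  assumes f: "f \<noteq> 0" and cd: "c \<noteq> 0 \<or> d \<noteq> 0"
  shows "moebius a b c d (degree f) f =
    Polynomial.smult (lead_coeff f) (\<Prod>\<beta>\<in>#proots f. [:b - d * \<beta>, a - c * \<beta>:])"
proof (rule poly_eqI_off_line[OF cd])
  fix x assume x: "c * x + d \<noteq> 0"
  have "(c * x + d) ^ size A * (\<Prod>\<beta>\<in>#A. (a * x + b) / (c * x + d) - \<beta>) =
      poly (\<Prod>\<beta>\<in>#A. [:b - d * \<beta>, a - c * \<beta>:]) x" for A
  proof (induction A)
    case (add \<beta> A)
    have "(c * x + d) * ((a * x + b) / (c * x + d) - \<beta>) = poly [:b - d * \<beta>, a - c * \<beta>:] x"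
      using x by (simp add: field_simps)
    hence "((c * x + d) * ((a * x + b) / (c * x + d) - \<beta>)) *
        ((c * x + d) ^ size A * (\<Prod>\<beta>\<in>#A. (a * x + b) / (c * x + d) - \<beta>)) =
        poly [:b - d * \<beta>, a - c * \<beta>:] x * poly (\<Prod>\<beta>\<in>#A. [:b - d * \<beta>, a - c * \<beta>:]) x"
      using add.IH by (simp only:)
    thus ?case by (simp only: size_add_mset image_mset_add_mset prod_mset.add_mset poly_mult
      power_Suc mult_ac)
  qed simp
  from this[of "proots f"]
  show "poly (moebius a b c d (degree f) f) x =
      poly (Polynomial.smult (lead_coeff f) (\<Prod>\<beta>\<in>#proots f. [:b - d * \<beta>, a - c * \<beta>:])) x"
    by (simp add: poly_moebius[OF order.refl x] poly_conv_proots[OF f] mult_ac)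
qed

lemma linear_factors:
  fixes A :: "complex multiset" and e h :: "complex \<Rightarrow> complex"
  assumes "\<And>\<beta>. \<beta> \<in># A \<Longrightarrow> h \<beta> \<noteq> 0"
  shows "lead_coeff (\<Prod>\<beta>\<in>#A. [:e \<beta>, h \<beta>:]) = (\<Prod>\<beta>\<in>#A. h \<beta>)"
    and "degree (\<Prod>\<beta>\<in>#A. [:e \<beta>, h \<beta>:]) = size A"
    and "proots (\<Prod>\<beta>\<in>#A. [:e \<beta>, h \<beta>:]) = image_mset (\<lambda>\<beta>. - e \<beta> / h \<beta>) A"
    and "(\<Prod>\<beta>\<in>#A. [:e \<beta>, h \<beta>:]) \<noteq> 0"
proof -
  have "lead_coeff (\<Prod>\<beta>\<in>#A. [:e \<beta>, h \<beta>:]) = (\<Prod>\<beta>\<in>#A. h \<beta>) \<and>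
    degree (\<Prod>\<beta>\<in>#A. [:e \<beta>, h \<beta>:]) = size A \<and>
    proots (\<Prod>\<beta>\<in>#A. [:e \<beta>, h \<beta>:]) = image_mset (\<lambda>\<beta>. - e \<beta> / h \<beta>) A \<and>
    (\<Prod>\<beta>\<in>#A. [:e \<beta>, h \<beta>:]) \<noteq> 0" using assms
  proof (induction A)
    case (add \<beta> A)
    let ?P = "\<Prod>\<beta>\<in>#A. [:e \<beta>, h \<beta>:]"
    have h: "h \<beta> \<noteq> 0" using add.prems by simp
    have P: "?P \<noteq> 0" "lead_coeff ?P = (\<Prod>\<beta>\<in>#A. h \<beta>)" "degree ?P = size A"
      "proots ?P = image_mset (\<lambda>\<beta>. - e \<beta> / h \<beta>) A" using add by auto
    have L: "[:e \<beta>, h \<beta>:] \<noteq> 0" using h by simp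
    have "[:e \<beta>, h \<beta>:] = Polynomial.smult (h \<beta>) [:- (- e \<beta> / h \<beta>), 1:]" using h by (simp add: nonzero_mult_div_cancel_left)
    hence "proots [:e \<beta>, h \<beta>:] = {#- e \<beta> / h \<beta>#}"
      using proots_smult[OF h] proots_linear_factor by (metis minus_minus)
    have "lead_coeff ([:e \<beta>, h \<beta>:] * ?P) = h \<beta> * (\<Prod>\<beta>\<in>#A. h \<beta>)"
      unfolding lead_coeff_mult P(2) using h by simp
    moreover have "degree ([:e \<beta>, h \<beta>:] * ?P) = Suc (size A)"
      using degree_mult_eq[OF L P(1)] P(3) h by simp
    ultimately show ?case
      using P L h \<open>proots [:e \<beta>, h \<beta>:] = {#- e \<beta> / h \<beta>#}\<close>
      by (simp del: mult_pCons_left add: proots_mult)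
  qed auto
  thus "lead_coeff (\<Prod>\<beta>\<in>#A. [:e \<beta>, h \<beta>:]) = (\<Prod>\<beta>\<in>#A. h \<beta>)"
    and "degree (\<Prod>\<beta>\<in>#A. [:e \<beta>, h \<beta>:]) = size A"
    and "proots (\<Prod>\<beta>\<in>#A. [:e \<beta>, h \<beta>:]) = image_mset (\<lambda>\<beta>. - e \<beta> / h \<beta>) A"
    and "(\<Prod>\<beta>\<in>#A. [:e \<beta>, h \<beta>:]) \<noteq> 0" by blast+
qed

lemma moebius_roots:
  fixes f :: "complex poly"
  assumes f: "f \<noteq> 0" and cd: "c \<noteq> 0 \<or> d \<noteq> 0"
    and pole: "\<forall>\<beta>\<in>#proots f. a - c * \<beta> \<noteq> 0"
  shows "degree (moebius a b c d (degree f) f) = degree f"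
    and "lead_coeff (moebius a b c d (degree f) f) = lead_coeff f * (\<Prod>\<beta>\<in>#proots f. a - c * \<beta>)"
    and "proots (moebius a b c d (degree f) f) =
           image_mset (\<lambda>\<beta>. (d * \<beta> - b) / (a - c * \<beta>)) (proots f)"
    and "moebius a b c d (degree f) f \<noteq> 0"
proof -
  note L = linear_factors[of "proots f" "\<lambda>\<beta>. a - c * \<beta>" "\<lambda>\<beta>. b - d * \<beta>",
    OF pole[rule_format], simplified minus_diff_eq]
  have l: "lead_coeff f \<noteq> 0" using f by simp
  note M = moebius_factor[OF f cd, of a b]
  show "degree (moebius a b c d (degree f) f) = degree f"
    unfolding M using L(2) l poly_conv_proots(2)[OF f] by simp
  show "lead_coeff (moebius a b c d (degree f) f) = lead_coeff f * (\<Prod>\<beta>\<in>#proots f. a - c * \<beta>)"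
    unfolding M lead_coeff_smult using L(1) by simp
  show "proots (moebius a b c d (degree f) f) =
           image_mset (\<lambda>\<beta>. (d * \<beta> - b) / (a - c * \<beta>)) (proots f)"
    unfolding M proots_smult[OF l] using L(3) by simp
  show "moebius a b c d (degree f) f \<noteq> 0" unfolding M using L(4) l by simp
qed

text \<open>
  Up to sign the resultant is \<open>lead_coeff g ^ n\<close> times the product of \<open>f \<beta>\<close> over the roots \<open>\<beta>\<close> of
  \<open>g\<close>. The substitution multiplies \<open>lead_coeff g\<close> by the product of the \<open>a - c \<beta>\<close>, and it divides the
  value of \<open>f\<close> at the root corresponding to \<open>\<beta>\<close> by \<open>(a - c \<beta>) ^ n\<close>; the two effects cancel.
\<close>

lemma resultant_moebius:
  fixes f g :: "complex poly"
  assumes det: "a * d - b * c = 1" and f: "f \<noteq> 0" "degree f = n" and g: "g \<noteq> 0" "degree g = n"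
    and pf: "\<forall>\<beta>\<in>#proots f. a - c * \<beta> \<noteq> 0"
    and pg: "\<forall>\<beta>\<in>#proots g. a - c * \<beta> \<noteq> 0"
  shows "resultant (moebius a b c d n f) (moebius a b c d n g) = resultant f g"
proof -
  have cd: "c \<noteq> 0 \<or> d \<noteq> 0" using det by auto
  note F = moebius_roots[OF f(1) cd pf, of b, unfolded f(2)]
  note G = moebius_roots[OF g(1) cd pg, of b, unfolded g(2)]
  have ev: "(a - c * \<beta>) ^ n * poly (moebius a b c d n f) ((d * \<beta> - b) / (a - c * \<beta>)) = poly f \<beta>"
    if "\<beta> \<in># proots g" for \<beta>
  proof -
    let ?x = "(d * \<beta> - b) / (a - c * \<beta>)"
    have nz: "a - c * \<beta> \<noteq> 0" using pg that by blast
    note inv = moebius_inverse[OF det nz]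
    have cx: "c * ?x + d \<noteq> 0" unfolding inv using nz by simp
    have "poly (moebius a b c d n f) ?x = (1 / (a - c * \<beta>)) ^ n * poly f \<beta>"
      using poly_moebius[of f n c ?x d a b, OF _ cx] f nz unfolding inv by simp
    thus ?thesis using nz by (simp add: power_divide)
  qed
  have pw: "(\<Prod>\<beta>\<in>#A. a - c * \<beta>) ^ n = (\<Prod>\<beta>\<in>#A. (a - c * \<beta>) ^ n)" for A
    by (induction A) (simp_all add: power_mult_distrib)
  have "(\<Prod>\<beta>\<in>#proots g. a - c * \<beta>) ^ n *
      (\<Prod>\<beta>\<in>#proots g. poly (moebius a b c d n f) ((d * \<beta> - b) / (a - c * \<beta>))) =
      (\<Prod>\<beta>\<in>#proots g. (a - c * \<beta>) ^ n * poly (moebius a b c d n f) ((d * \<beta> - b) / (a - c * \<beta>)))"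
    by (simp add: prod_mset.distrib pw)
  also have "\<dots> = (\<Prod>\<beta>\<in>#proots g. poly f \<beta>)"
    by (intro arg_cong[of _ _ prod_mset] image_mset_cong ev)
  finally have key: "(\<Prod>\<beta>\<in>#proots g. a - c * \<beta>) ^ n *
      (\<Prod>\<beta>\<in>#proots g. poly (moebius a b c d n f) ((d * \<beta> - b) / (a - c * \<beta>))) =
      (\<Prod>\<beta>\<in>#proots g. poly f \<beta>)" .
  have lc: "coeff (moebius a b c d n g) n = coeff g n * (\<Prod>\<beta>\<in>#proots g. a - c * \<beta>)"
    using G(2) unfolding G(1) .
  have "resultant (moebius a b c d n f) (moebius a b c d n g) =
      (-1) ^ (n * n) * (coeff g n * (\<Prod>\<beta>\<in>#proots g. a - c * \<beta>)) ^ n *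
      (\<Prod>\<beta>\<in>#proots g. poly (moebius a b c d n f) ((d * \<beta> - b) / (a - c * \<beta>)))"
    by (simp only: resultant_conv_roots_complex[OF F(4) G(4)] roots_resultant_eval[OF F(4) G(4)]
      F(1) G(1,3) lc multiset.map_comp o_def)
  also have "\<dots> = (-1) ^ (n * n) * coeff g n ^ n * (\<Prod>\<beta>\<in>#proots g. poly f \<beta>)"
    by (simp only: power_mult_distrib key[symmetric] mult.assoc)
  also have "\<dots> = resultant f g"
    by (simp only: resultant_conv_roots_complex[OF f(1) g(1)] roots_resultant_eval[OF f(1) g(1)]
      f(2) g(2))
  finally show ?thesis .
qed

section \<open>Counting coprime pairs\<close>

definition coprime_pairs :: "nat \<Rightarrow> (nat \<times> nat) set" where
  "coprime_pairs M = {(x, y). x \<in> {1..M} \<and> y \<in> {1..M} \<and> coprime x y}"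

lemma finite_coprime_pairs: "finite (coprime_pairs M)"
  by (rule finite_subset[of _ "{1..M} \<times> {1..M}"]) (auto simp: coprime_pairs_def)

lemma sum_inverse_squares: "M \<ge> 2 \<Longrightarrow> (\<Sum>g=2..M. 1 / real g ^ 2) \<le> 3 / 4 - 1 / real M"
proof (induction M rule: dec_induct)
  case (step M)
  have "1 / real (Suc M) ^ 2 \<le> 1 / (real M * real (Suc M))"
    using step.hyps by (intro divide_left_mono) (auto simp: power2_eq_square)
  also have "\<dots> = 1 / real M - 1 / real (Suc M)"
    using step.hyps by (simp add: field_simps)
  finally show ?case using step by simp
qed simp

text \<open>
  Dividing a pair by its gcd \<open>g\<close> gives a coprime pair with entries up to \<open>M div g\<close>, so the \<open>M\<^sup>2\<close>
  pairs are covered by copies of the sets \<open>coprime_pairs (M div g)\<close>. Those with \<open>g \<ge> 2\<close> contain at most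
  \<open>M\<^sup>2 / g\<^sup>2\<close> pairs each, and these bounds add up to less than \<open>3 / 4\<close> of \<open>M\<^sup>2\<close>.
\<close>

lemma card_coprime_pairs: "real M ^ 2 \<le> 4 * real (card (coprime_pairs M))"
proof (cases "M \<ge> 2")
  case True
  let ?C = "\<lambda>g. card (coprime_pairs (M div g))"
  have "{1..M} \<times> {1..M} \<subseteq> (\<Union>g\<in>{1..M}. (\<lambda>(x, y). (g * x, g * y)) ` coprime_pairs (M div g))"
  proof clarsimp
    fix x y :: nat assume xy: "Suc 0 \<le> x" "x \<le> M" "Suc 0 \<le> y" "y \<le> M"
    define g where "g = gcd x y"
    have g: "g > 0" "g dvd x" "g dvd y" using xy by (auto simp: g_def)
    have "g \<le> x" using g xy by (intro dvd_imp_le) auto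
    moreover have "(x, y) \<in> (\<lambda>(x, y). (g * x, g * y)) ` coprime_pairs (M div g)"
    proof (rule image_eqI)
      show "(x, y) = (\<lambda>(x, y). (g * x, g * y)) (x div g, y div g)" using g by simp
      have "x div g \<ge> 1" "y div g \<ge> 1"
        using g xy by (simp_all add: Suc_le_eq div_greater_zero_iff dvd_imp_le)
      moreover have "x div g \<le> M div g" "y div g \<le> M div g" using xy by (simp_all add: div_le_mono)
      moreover have "coprime (x div g) (y div g)"
        unfolding g_def using xy by (intro div_gcd_coprime) auto
      ultimately show "(x div g, y div g) \<in> coprime_pairs (M div g)"
        by (simp add: coprime_pairs_def)
    qed
    ultimately show "\<exists>g\<in>{Suc 0..M}. (x, y) \<in> (\<lambda>(x, y). (g * x, g * y)) ` coprime_pairs (M div g)"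
      using g(1) xy by (intro bexI[of _ g]) (assumption, simp)
  qed
  hence "card ({1..M} \<times> {1..M}) \<le>
      card (\<Union>g\<in>{1..M}. (\<lambda>(x, y). (g * x, g * y)) ` coprime_pairs (M div g))"
    by (intro card_mono) (auto intro: finite_coprime_pairs)
  also have "\<dots> \<le> (\<Sum>g=1..M. card ((\<lambda>(x, y). (g * x, g * y)) ` coprime_pairs (M div g)))"
    by (rule card_UN_le) simp
  also have "\<dots> \<le> (\<Sum>g=1..M. ?C g)"
    by (intro sum_mono card_image_le finite_coprime_pairs)
  finally have "real (M ^ 2) \<le> real (\<Sum>g=1..M. ?C g)"
    by (simp add: power2_eq_square del: of_nat_mult of_nat_sum)
  also have "(\<Sum>g=1..M. ?C g) = ?C 1 + (\<Sum>g=2..M. ?C g)"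
    using True by (subst sum.atLeast_Suc_atMost) (auto simp: numeral_2_eq_2)
  also have "real \<dots> = real (card (coprime_pairs M)) + (\<Sum>g=2..M. real (?C g))" by simp
  also have "(\<Sum>g=2..M. real (?C g)) \<le> (\<Sum>g=2..M. real M ^ 2 * (1 / real g ^ 2))"
  proof (intro sum_mono)
    fix g assume g: "g \<in> {2..M}"
    have "real (M div g * g) \<le> real M" by (simp only: of_nat_le_iff div_times_less_eq_dividend)
    hence div: "real (M div g) \<le> real M / real g" using g by (simp add: le_divide_eq)
    have "?C g \<le> card ({1..M div g} \<times> {1..M div g})"
      by (intro card_mono) (auto simp: coprime_pairs_def)
    hence "real (?C g) \<le> real ((M div g) ^ 2)"
      by (simp add: power2_eq_square del: of_nat_mult)
    also have "\<dots> = real (M div g) ^ 2" by simp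
    also have "\<dots> \<le> (real M / real g) ^ 2"
      by (intro power_mono div) auto
    finally show "real (?C g) \<le> real M ^ 2 * (1 / real g ^ 2)" by (simp add: power_divide)
  qed
  also have "\<dots> = real M ^ 2 * (\<Sum>g=2..M. 1 / real g ^ 2)" by (simp only: sum_distrib_left)
  also have "\<dots> \<le> real M ^ 2 * (3 / 4)"
  proof (intro mult_left_mono)
    have "0 \<le> 1 / real M" by simp
    thus "(\<Sum>g=2..M. 1 / real g ^ 2) \<le> 3 / 4" using sum_inverse_squares[OF True] by linarith
  qed simp
  finally show ?thesis by simp
next
  case False
  hence M: "M = 0 \<or> M = 1" by auto
  have "coprime_pairs 1 = {(1, 1)}" by (auto simp: coprime_pairs_def)
  hence "card (coprime_pairs 1) = 1" by simp
  with M show ?thesis by (elim disjE) simp_all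
qed

lemma card_ordered_coprime_pairs:
  "real T ^ 2 \<le> 8 * real (card {(c, d) \<in> coprime_pairs T. d \<le> c})"
proof -
  let ?O = "{(c, d) \<in> coprime_pairs T. d \<le> c}"
  have fin: "finite ?O" by (rule finite_subset[OF _ finite_coprime_pairs[of T]]) auto
  have "coprime_pairs T \<subseteq> ?O \<union> prod.swap ` ?O"
    by (auto simp: coprime_pairs_def coprime_commute image_iff)
  hence "card (coprime_pairs T) \<le> card ?O + card (prod.swap ` ?O)"
    using fin by (meson card_Un_le card_mono finite_UnI finite_imageI le_trans)
  also have "\<dots> \<le> card ?O + card ?O" using card_image_le[OF fin] by simp
  finally show ?thesis using card_coprime_pairs[of T] by linarith
qed

text \<open>
  The pairs \<open>(u, v)\<close> serve as constant coefficient \<open>- 2 u\<close> and leading coefficient \<open>v\<close>. Parity is what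
  Eisenstein's criterion at 2 asks for, coprimality makes the polynomial primitive, and the lower
  bound on \<open>v\<close> keeps its roots bounded.
\<close>

definition odd_pairs :: "nat \<Rightarrow> (nat \<times> nat) set" where
  "odd_pairs M = {(u, v) \<in> coprime_pairs (2 * M). odd u \<and> odd v \<and> M < 8 * v}"

lemma finite_odd_pairs: "finite (odd_pairs M)"
  by (rule finite_subset[OF _ finite_coprime_pairs[of "2 * M"]]) (auto simp: odd_pairs_def)

text \<open>
  A coprime pair has at most one even entry. Adding the other entry to it makes both entries odd and
  keeps the pair coprime, so at most three coprime pairs share the same odd one.
\<close>

lemma card_odd_pairs: "real M ^ 2 \<le> 24 * real (card (odd_pairs M))"
proof -
  let ?C = "{(x, y) \<in> coprime_pairs M. M < 8 * y}" and ?O = "odd_pairs M"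
  let ?L = "{1..M} \<times> {1..M div 8}"
  let ?f = "\<lambda>(u, v). (u - v, v :: nat)" and ?g = "\<lambda>(u, v). (u :: nat, v - u)"
  have fin: "finite ?O" by (rule finite_odd_pairs)
  have "coprime_pairs M \<subseteq> ?C \<union> ?L" by (auto simp: coprime_pairs_def)
  hence "card (coprime_pairs M) \<le> card (?C \<union> ?L)"
    by (intro card_mono finite_UnI finite_subset[OF _ finite_coprime_pairs[of M], of ?C]) auto
  also have "\<dots> \<le> card ?C + card ?L" by (rule card_Un_le)
  finally have 1: "card (coprime_pairs M) \<le> card ?C + M * (M div 8)" by simp
  have "8 * (M * (M div 8)) \<le> M * M" using mult_le_mono2[of "8 * (M div 8)" M M] by simp
  hence "8 * real (M * (M div 8)) \<le> real M ^ 2"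
    by (metis of_nat_le_iff of_nat_mult of_nat_numeral power2_eq_square)
  with 1 card_coprime_pairs[of M] have 2: "real M ^ 2 \<le> 8 * real (card ?C)" by linarith
  have "?C \<subseteq> ?O \<union> (?f ` ?O \<union> ?g ` ?O)"
  proof
    fix p assume "p \<in> ?C"
    then obtain x y where p: "p = (x, y)" and xy: "(x, y) \<in> coprime_pairs M" "M < 8 * y" by auto
    have "coprime x y" using xy by (simp add: coprime_pairs_def)
    moreover from this have "coprime y x" by (simp add: coprime_commute)
    ultimately have cop: "coprime (x + y) y" "coprime (y + x) x"
      by (simp_all add: coprime_iff_gcd_eq_1)
    hence cop': "coprime x (y + x)" by (simp add: coprime_commute)
    have par: "odd x \<or> odd y" using coprime_common_divisor[OF \<open>coprime x y\<close>, of 2] by auto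
    consider "odd x" "odd y" | "even x" "odd y" | "even y" "odd x" using par by auto
    thus "p \<in> ?O \<union> (?f ` ?O \<union> ?g ` ?O)"
    proof cases
      case 1
      hence "p \<in> ?O" using p xy by (auto simp: odd_pairs_def coprime_pairs_def)
      thus ?thesis by blast
    next
      case 2
      hence "(x + y, y) \<in> ?O" using xy cop by (auto simp: odd_pairs_def coprime_pairs_def)
      moreover have "p = ?f (x + y, y)" using p by simp
      ultimately show ?thesis by blast
    next
      case 3
      hence "(x, y + x) \<in> ?O" using xy cop' by (auto simp: odd_pairs_def coprime_pairs_def)
      moreover have "p = ?g (x, y + x)" using p by simp
      ultimately show ?thesis by blast
    qed
  qed
  hence "card ?C \<le> card (?O \<union> (?f ` ?O \<union> ?g ` ?O))" using fin by (intro card_mono) auto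
  also have "\<dots> \<le> card ?O + (card (?f ` ?O) + card (?g ` ?O))"
    using card_Un_le[of ?O "?f ` ?O \<union> ?g ` ?O"] card_Un_le[of "?f ` ?O" "?g ` ?O"] by linarith
  also have "\<dots> \<le> card ?O + (card ?O + card ?O)"
    using card_image_le[OF fin, of ?f] card_image_le[OF fin, of ?g] by linarith
  finally show ?thesis using 2 by linarith
qed

text \<open>
  The entry \<open>a\<close> only has to be an inverse of \<open>d\<close> modulo \<open>c\<close>, so it can be found in any interval of
  length \<open>c\<close>. Choosing it large compared with \<open>c\<close> will keep the pole \<open>a / c\<close> away from the roots.
\<close>

lemma unimodular_completion:
  fixes c d T K :: nat
  assumes "(c, d) \<in> coprime_pairs T" "d \<le> c" "K \<ge> 1"
  shows "\<exists>a b :: int. a * int d - b * int c = 1 \<and> int (K * T) \<le> a \<and> a \<le> int ((K + 1) * T) \<and>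
           0 \<le> b \<and> b \<le> int ((K + 1) * T)"
proof -
  have cd: "c \<ge> 1" "c \<le> T" "d \<ge> 1" "coprime (int d) (int c)"
    using assms by (auto simp: coprime_pairs_def coprime_commute)
  obtain a0 where a0: "[int d * a0 = 1] (mod int c)" using cong_solve_coprime_int[OF cd(4)] by blast
  define a where "a = int (K * T) + (a0 - int (K * T)) mod int c"
  have "a mod int c = a0 mod int c" by (simp add: a_def mod_add_right_eq)
  hence "[int d * a = 1] (mod int c)"
    using a0 by (metis cong_def mod_mult_right_eq)
  hence "int c dvd a * int d - 1" by (simp add: cong_iff_dvd_diff mult.commute)
  then obtain b where b: "a * int d - 1 = int c * b" by (elim dvdE)
  have al: "int (K * T) \<le> a" using cd by (simp add: a_def)
  have "(a0 - int (K * T)) mod int c < int c" using cd by simp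
  hence "a \<le> int (K * T) + int T" using cd unfolding a_def by linarith
  hence au: "a \<le> int ((K + 1) * T)" by (simp add: algebra_simps)
  have "K * T \<ge> 1" using assms(3) cd by simp
  hence a1: "a \<ge> 1" using al by linarith
  hence "a * int d \<ge> 1 * 1" using cd by (intro mult_mono) auto
  hence "int c * b \<ge> 0" using b by simp
  hence b0: "b \<ge> 0" using cd by (simp add: zero_le_mult_iff)
  have "a * int d \<le> a * int c" using assms(2) a1 by (intro mult_left_mono) auto
  hence "int c * b < int c * a" using b mult.commute[of a "int c"] by linarith
  hence "b < a" using cd by (simp add: mult_less_cancel_left)
  with al au b b0 show ?thesis by (intro exI[of _ a] exI[of _ b]) (auto simp: mult.commute)
qed

section \<open>Integer polynomials with prescribed coefficient ranges and Eisenstein's criterion\<close>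

definition poly_box :: "nat \<Rightarrow> (nat \<Rightarrow> int set) \<Rightarrow> int poly set" where
  "poly_box n A = {p. degree p \<le> n \<and> (\<forall>i\<le>n. coeff p i \<in> A i)}"

lemma bij_betw_poly_box:
  "bij_betw (\<lambda>p. restrict (coeff p) {..n}) (poly_box n A) (PiE {..n} A)"
proof (rule bij_betwI[where g = "\<lambda>f. \<Sum>i\<le>n. monom (f i) i"])
  have coeff: "coeff (\<Sum>i\<le>n. monom (f i) i) k = (if k \<le> n then f k else 0)" for f :: "nat \<Rightarrow> int" and k
    by (simp add: coeff_sum)
  have deg: "degree (\<Sum>i\<le>n. monom (f i) i) \<le> n" for f :: "nat \<Rightarrow> int"
    by (intro degree_le) (simp add: coeff)
  show "(\<lambda>p. restrict (coeff p) {..n}) \<in> poly_box n A \<rightarrow> PiE {..n} A"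
    by (auto simp: poly_box_def)
  show "(\<lambda>f. \<Sum>i\<le>n. monom (f i) i) \<in> PiE {..n} A \<rightarrow> poly_box n A"
    using deg by (auto simp: poly_box_def coeff)
  show "(\<Sum>i\<le>n. monom (restrict (coeff p) {..n} i) i) = p" if "p \<in> poly_box n A" for p
    using that by (intro poly_eqI) (auto simp: coeff poly_box_def coeff_eq_0)
  show "restrict (coeff (\<Sum>i\<le>n. monom (f i) i)) {..n} = f" if "f \<in> PiE {..n} A" for f
  proof
    fix k show "restrict (coeff (\<Sum>i\<le>n. monom (f i) i)) {..n} k = f k"
      using PiE_arb[OF that, of k] by (cases "k \<le> n") (simp_all add: coeff)
  qed
qed

lemma card_poly_box: "card (poly_box n A) = (\<Prod>i\<le>n. card (A i))"
  using bij_betw_same_card[OF bij_betw_poly_box[of n A]] by (simp add: card_PiE)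

lemma finite_poly_box: "(\<And>i. i \<le> n \<Longrightarrow> finite (A i)) \<Longrightarrow> finite (poly_box n A)"
  using bij_betw_finite[OF bij_betw_poly_box[of n A]] by (auto intro!: finite_PiE)

text \<open>
  Eisenstein's argument: the lowest odd coefficient of \<open>D\<close> times the odd constant term of \<open>E\<close> produces an
  odd coefficient of \<open>D * E\<close> at the same place, which can only be the leading one.
\<close>

lemma eisenstein_cofactor:
  fixes D E :: "int poly"
  assumes lead: "odd (coeff (D * E) n)" and low: "\<And>i. i < n \<Longrightarrow> even (coeff (D * E) i)"
    and deg: "degree (D * E) = n" and D0: "even (coeff D 0)" and E0: "odd (coeff E 0)"
  shows "degree E = 0"
proof -
  have nz: "D \<noteq> 0" "E \<noteq> 0" using lead by auto
  hence sum: "degree D + degree E = n" using deg by (simp add: degree_mult_eq)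
  have "coeff (D * E) n = lead_coeff D * lead_coeff E" using coeff_mult_degree_sum[of D E] sum by simp
  with lead have "odd (lead_coeff D)" by simp
  then obtain i where i: "odd (coeff D i)" "\<And>j. j < i \<Longrightarrow> even (coeff D j)"
    using exists_least_iff[of "\<lambda>i. odd (coeff D i)"] by blast
  have "coeff (D * E) i = (\<Sum>j\<le>i. coeff D j * coeff E (i - j))" by (rule coeff_mult)
  also have "\<dots> = coeff D i * coeff E 0 + (\<Sum>j<i. coeff D j * coeff E (i - j))"
    by (simp add: lessThan_Suc_atMost[symmetric])
  finally have eq: "coeff (D * E) i = coeff D i * coeff E 0 + (\<Sum>j<i. coeff D j * coeff E (i - j))" .
  have "even (\<Sum>j<i. coeff D j * coeff E (i - j))" using i(2) by (intro dvd_sum) auto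
  hence "odd (coeff (D * E) i)" using i(1) E0 unfolding eq by simp
  hence "\<not> i < n" using low by blast
  moreover have "i \<le> degree D" using i(1) by (intro le_degree) auto
  ultimately show ?thesis using sum by linarith
qed

lemma eisenstein_at_2:
  fixes D E :: "int poly"
  assumes n: "n \<ge> 1" and lead: "odd (coeff (D * E) n)" and low: "\<And>i. i < n \<Longrightarrow> even (coeff (D * E) i)"
    and const: "\<not> 4 dvd coeff (D * E) 0" and deg: "degree (D * E) = n" and D: "degree D \<noteq> 0"
  shows "degree E = 0"
proof -
  have c0: "coeff (D * E) 0 = coeff D 0 * coeff E 0" by (simp add: coeff_mult)
  have "even (coeff D 0 * coeff E 0)" using low[of 0] n c0 by simp
  moreover have "\<not> (even (coeff D 0) \<and> even (coeff E 0))"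
    using const c0 mult_dvd_mono[of 2 "coeff D 0" 2 "coeff E 0"] by auto
  ultimately consider "even (coeff D 0)" "odd (coeff E 0)" | "even (coeff E 0)" "odd (coeff D 0)"
    by auto
  thus ?thesis
  proof cases
    case 1
    from eisenstein_cofactor[OF lead low deg this] show ?thesis .
  next
    case 2
    from eisenstein_cofactor[of E D n] lead low deg 2 D show ?thesis by (simp add: mult.commute)
  qed
qed

definition eisenstein_box :: "nat \<Rightarrow> nat \<Rightarrow> nat \<Rightarrow> nat \<Rightarrow> int poly set" where
  "eisenstein_box n M u v = poly_box n (\<lambda>i. if i = 0 then {- 2 * int u} else if i = n then {int v}
     else (\<lambda>m. 2 * int m) ` {1..M})"

definition eisenstein_polys :: "nat \<Rightarrow> nat \<Rightarrow> int poly set" where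
  "eisenstein_polys n M = (\<Union>(u, v)\<in>odd_pairs M. eisenstein_box n M u v)"

lemma eisenstein_boxD:
  assumes "F \<in> eisenstein_box n M u v" "n \<ge> 1"
  shows "coeff F 0 = - 2 * int u" "coeff F n = int v" "degree F \<le> n"
    "\<And>i. 0 < i \<Longrightarrow> i < n \<Longrightarrow> even (coeff F i) \<and> 0 < coeff F i \<and> coeff F i \<le> 2 * int M"
proof -
  have A: "coeff F i \<in> (if i = 0 then {- 2 * int u} else if i = n then {int v}
     else (\<lambda>m. 2 * int m) ` {1..M})" if "i \<le> n" for i
    using assms(1) that unfolding eisenstein_box_def poly_box_def by blast
  show "coeff F 0 = - 2 * int u" using A[of 0] by simp
  show "coeff F n = int v" using A[of n] assms(2) by simp
  show "degree F \<le> n" using assms(1) by (simp add: eisenstein_box_def poly_box_def)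
  show "even (coeff F i) \<and> 0 < coeff F i \<and> coeff F i \<le> 2 * int M" if "0 < i" "i < n" for i
    using A[of i] that by auto
qed

lemma card_eisenstein_box:
  assumes "n \<ge> 1"
  shows "card (eisenstein_box n M u v) = M ^ (n - 1)"
proof -
  let ?A = "\<lambda>i. if i = 0 then {- 2 * int u} else if i = n then {int v}
     else (\<lambda>m. 2 * int m) ` {1..M}"
  have c: "card ((\<lambda>m. 2 * int m) ` {1..M}) = M" by (subst card_image) (auto simp: inj_on_def)
  have "{..n} = insert 0 (insert n {1..<n})" using assms by auto
  hence "(\<Prod>i\<le>n. card (?A i)) = (\<Prod>i\<in>insert 0 (insert n {1..<n}). card (?A i))" by simp
  also have "\<dots> = (\<Prod>i\<in>{1..<n}. card (?A i))" using assms by (simp add: prod.insert)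
  also have "\<dots> = (\<Prod>i\<in>{1..<n}. M)" using c by (intro prod.cong) auto
  finally show ?thesis by (simp add: eisenstein_box_def card_poly_box)
qed

lemma finite_eisenstein_box: "finite (eisenstein_box n M u v)"
  unfolding eisenstein_box_def by (rule finite_poly_box) auto

lemma finite_eisenstein_polys: "finite (eisenstein_polys n M)"
  unfolding eisenstein_polys_def using finite_odd_pairs finite_eisenstein_box by auto

lemma card_eisenstein_polys:
  assumes "n \<ge> 1"
  shows "real M ^ (n + 1) \<le> 24 * real (card (eisenstein_polys n M))"
proof -
  have "card (eisenstein_polys n M) = (\<Sum>(u, v)\<in>odd_pairs M. card (eisenstein_box n M u v))"
    unfolding eisenstein_polys_def case_prod_unfold
  proof (rule card_UN_disjoint)
    show "\<forall>p\<in>odd_pairs M. \<forall>q\<in>odd_pairs M. p \<noteq> q \<longrightarrow>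
        eisenstein_box n M (fst p) (snd p) \<inter> eisenstein_box n M (fst q) (snd q) = {}"
    proof (intro ballI impI)
      fix p q :: "nat \<times> nat" assume "p \<noteq> q"
      have "p = q" if "F \<in> eisenstein_box n M (fst p) (snd p)" "F \<in> eisenstein_box n M (fst q) (snd q)" for F
        using eisenstein_boxD(1,2)[OF that(1) assms] eisenstein_boxD(1,2)[OF that(2) assms] by (simp add: prod_eq_iff)
      with \<open>p \<noteq> q\<close> show "eisenstein_box n M (fst p) (snd p) \<inter> eisenstein_box n M (fst q) (snd q) = {}" by blast
    qed
  qed (auto simp: finite_odd_pairs finite_eisenstein_box)
  also have "\<dots> = card (odd_pairs M) * M ^ (n - 1)" by (simp add: card_eisenstein_box[OF assms] case_prod_unfold)
  finally have card: "real (card (eisenstein_polys n M)) = real (card (odd_pairs M)) * real M ^ (n - 1)" by simp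
  have "real M ^ (n + 1) = real M ^ 2 * real M ^ (n - 1)" using assms by (simp flip: power_add)
  also have "\<dots> \<le> (24 * real (card (odd_pairs M))) * real M ^ (n - 1)"
    by (intro mult_right_mono card_odd_pairs) simp
  finally show ?thesis by (simp add: card)
qed

lemma eisenstein_polysE:
  assumes "F \<in> eisenstein_polys n M" "n \<ge> 1"
  obtains u v where "odd u" "odd v" "coprime u v" "u \<ge> 1" "u \<le> 2 * M" "v \<le> 2 * M" "M < 8 * v"
    "coeff F 0 = - 2 * int u" "coeff F n = int v" "degree F = n" "F \<noteq> 0"
    "\<And>i. 0 < i \<Longrightarrow> i < n \<Longrightarrow> even (coeff F i) \<and> 0 < coeff F i \<and> coeff F i \<le> 2 * int M"
    "\<And>i. \<bar>coeff F i\<bar> \<le> 4 * int M"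
proof -
  obtain u v where uv: "(u, v) \<in> odd_pairs M" and F: "F \<in> eisenstein_box n M u v"
    using assms(1) by (auto simp: eisenstein_polys_def)
  note D = eisenstein_boxD[OF F assms(2)]
  have p: "odd u" "odd v" "coprime u v" "u \<ge> 1" "u \<le> 2 * M" "v \<le> 2 * M" "M < 8 * v"
    using uv by (auto simp: odd_pairs_def coprime_pairs_def)
  have "coeff F n \<noteq> 0" using D p by auto
  hence deg: "degree F = n" "F \<noteq> 0" using D(3) le_degree[of F n] by auto
  have "\<bar>coeff F i\<bar> \<le> 4 * int M" for i
  proof -
    consider "i = 0" | "i = n" | "0 < i" "i < n" | "i > n" by linarith
    thus ?thesis
    proof cases
      case 1 thus ?thesis using D(1) p by simp
    next
      case 2 thus ?thesis using D(2) p by simp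
    next
      case 3 thus ?thesis using D(4)[of i] by auto
    next
      case 4 thus ?thesis using deg by (simp add: coeff_eq_0)
    qed
  qed
  with that p D deg show thesis by blast
qed

text \<open>
  A vanishing resultant means a nonconstant common divisor of \<open>F\<close> and \<open>G\<close>. By Eisenstein's criterion
  it has full degree \<open>n\<close>, and as the coefficients of \<open>F\<close> have no common prime factor it equals \<open>F\<close> up to
  sign. Then \<open>G\<close> is a nonzero integer multiple of \<open>F\<close>, which contradicts the size of its coefficient
  at \<open>n\<close>.
\<close>

lemma resultant_perturbed_nonzero:
  assumes F: "F \<in> eisenstein_polys n M" and n: "n \<ge> 1" and G: "G \<noteq> 0" "degree G \<le> n"
    and small: "16 * \<bar>coeff G n\<bar> \<le> int M"
  shows "resultant (F + G) F \<noteq> 0"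
proof
  assume res: "resultant (F + G) F = 0"
  obtain u v where uv: "odd u" "odd v" "coprime u v" "M < 8 * v" and F0: "coeff F 0 = - 2 * int u"
    and Fn: "coeff F n = int v" and deg: "degree F = n" "F \<noteq> 0"
    and mid: "\<And>i. 0 < i \<Longrightarrow> i < n \<Longrightarrow> even (coeff F i) \<and> 0 < coeff F i \<and> coeff F i \<le> 2 * int M"
    using eisenstein_polysE[OF F n] by metis
  define D where "D = gcd (F + G) F"
  have D: "degree D \<noteq> 0" using res unfolding resultant_0_gcd D_def .
  have "D dvd F" "D dvd F + G" by (simp_all add: D_def)
  hence "D dvd G" using dvd_diff[of D "F + G" F] by simp
  obtain E where E: "F = D * E" using \<open>D dvd F\<close> by (elim dvdE)
  obtain E' where E': "G = D * E'" using \<open>D dvd G\<close> by (elim dvdE)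
  have "even (coeff F i)" if "i < n" for i
    using F0 mid[of i] that by (cases "i = 0") auto
  moreover have "\<not> 4 dvd coeff F 0"
  proof
    assume "4 dvd coeff F 0"
    then obtain k where "- 2 * int u = 4 * k" unfolding F0 by (elim dvdE)
    hence "int u = 2 * (- k)" by simp
    hence "even (int u)" by (metis dvd_triv_left)
    with uv(1) show False by simp
  qed
  ultimately have "degree E = 0"
    using eisenstein_at_2[OF n, of D E] D deg uv(2) Fn unfolding E by simp
  then obtain k where k: "E = [:k:]" by (elim degree_eq_zeroE)
  have coeffF: "coeff F i = coeff D i * k" for i by (simp add: E k)
  have "degree D = n" using deg E k by (metis \<open>degree E = 0\<close> add.right_neutral degree_mult_eq mult_eq_0_iff)
  moreover have "degree G = degree D + degree E'" using G E' by (metis degree_mult_eq mult_eq_0_iff)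
  ultimately have "degree E' = 0" using G by simp
  then obtain k' where k': "E' = [:k':]" by (elim degree_eq_zeroE)
  have "k dvd int v" "k dvd 2 * int u"
    using coeffF[of n] coeffF[of 0] F0 Fn by (metis dvd_triv_right, metis dvd_minus_iff dvd_triv_right mult_minus_left)
  moreover have "coprime (2 * int u) (int v)" using uv by (simp add: coprime_commute)
  ultimately have "is_unit k" by (meson coprime_common_divisor)
  hence k1: "\<bar>k\<bar> = 1" by simp
  have "k' \<noteq> 0" using G E' k' by auto
  have "coeff G n = coeff D n * k'" by (simp add: E' k')
  hence "\<bar>coeff G n\<bar> = \<bar>coeff F n\<bar> * \<bar>k'\<bar>" using coeffF[of n] k1 by (simp add: abs_mult)
  also have "\<dots> \<ge> \<bar>coeff F n\<bar> * 1" using \<open>k' \<noteq> 0\<close> by (intro mult_left_mono) auto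
  finally have "int v \<le> \<bar>coeff G n\<bar>" using Fn by simp
  with small uv(4) show False by linarith
qed

section \<open>Roots and small values\<close>

text \<open>
  Cauchy's bound: at a root of modulus above 1 the leading term must be balanced by \<open>n\<close> terms, each at most
  \<open>A * norm z ^ (n - 1)\<close>.
\<close>

lemma root_bound:
  fixes f :: "complex poly"
  assumes n: "degree f = n" "n \<ge> 1" and h: "h > 0" "h \<le> norm (coeff f n)"
    and A: "\<And>i. i < n \<Longrightarrow> norm (coeff f i) \<le> A" and B: "real n * A \<le> B * h" "B \<ge> 1"
    and z: "poly f z = 0"
  shows "norm z \<le> B"
proof (cases "norm z \<le> 1")
  case False
  hence z1: "norm z \<ge> 1" "norm z > 0" by auto
  obtain m where m: "n = Suc m" using n(2) by (cases n) auto
  have A0: "A \<ge> 0" using order_trans[OF norm_ge_zero A[of 0]] n(2) by simp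
  have "poly f z = (\<Sum>i<n. coeff f i * z ^ i) + coeff f n * z ^ n"
    by (simp add: poly_altdef n(1) flip: lessThan_Suc_atMost)
  hence "coeff f n * z ^ n = - (\<Sum>i<n. coeff f i * z ^ i)" using z by (simp add: eq_neg_iff_add_eq_0 add.commute)
  hence "norm (coeff f n) * norm z ^ n = norm (\<Sum>i<n. coeff f i * z ^ i)"
    by (metis norm_minus_cancel norm_mult norm_power)
  also have "\<dots> \<le> (\<Sum>i<n. norm (coeff f i * z ^ i))" by (rule norm_sum)
  also have "\<dots> \<le> (\<Sum>i<n. A * norm z ^ m)"
  proof (intro sum_mono)
    fix i assume "i \<in> {..<n}"
    thus "norm (coeff f i * z ^ i) \<le> A * norm z ^ m"
      unfolding norm_mult norm_power using A0 z1 m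
      by (intro mult_mono A power_increasing) auto
  qed
  also have "\<dots> = real n * A * norm z ^ m" by simp
  finally have "norm (coeff f n) * norm z * norm z ^ m \<le> real n * A * norm z ^ m"
    by (simp add: m mult_ac)
  hence "norm (coeff f n) * norm z \<le> real n * A" using z1 by simp
  moreover have "h * norm z \<le> norm (coeff f n) * norm z" using h by (intro mult_right_mono) auto
  ultimately have "h * norm z \<le> h * B" using B(1) by (simp add: mult.commute)
  thus ?thesis using h(1) by simp
qed (use B in auto)

text \<open>
  The leading coefficient of \<open>F\<close> exceeds \<open>M / 8\<close> and that of \<open>G\<close> is at most \<open>M / 16\<close>, so \<open>F + G\<close> keeps
  a leading coefficient above \<open>M / 16\<close> against coefficients up to \<open>5 M\<close>; this is where \<open>80 n\<close>
  comes from. The case \<open>G = 0\<close> covers \<open>F\<close> itself.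
\<close>

lemma perturbed_roots:
  assumes F: "F \<in> eisenstein_polys n M" and n: "n \<ge> 1"
    and G: "degree G \<le> n" "\<And>i. i \<le> n \<Longrightarrow> 16 * \<bar>coeff G i\<bar> \<le> int M"
  shows "degree (F + G) = n" "F + G \<noteq> 0" "\<And>i. \<bar>coeff (F + G) i\<bar> \<le> 5 * int M"
    and "\<And>z. poly (map_poly complex_of_int (F + G)) z = 0 \<Longrightarrow> norm z \<le> 80 * real n"
proof -
  obtain u v where v: "odd v" "M < 8 * v" and deg: "degree F = n"
    and Fn: "coeff F n = int v" and Fc: "\<And>i. \<bar>coeff F i\<bar> \<le> 4 * int M"
    using eisenstein_polysE[OF F n] by metis
  have lead: "int M < 16 * coeff (F + G) n" using v(2) G(2)[of n] Fn by simp
  hence nz: "coeff (F + G) n \<noteq> 0" by auto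
  hence "degree (F + G) \<ge> n" by (rule le_degree)
  moreover have "degree (F + G) \<le> n" using degree_add_le[of F n G] deg G(1) by simp
  ultimately show d: "degree (F + G) = n" by simp
  show "F + G \<noteq> 0" using nz by (metis coeff_0)
  show c: "\<bar>coeff (F + G) i\<bar> \<le> 5 * int M" for i
  proof (cases "i \<le> n")
    case True thus ?thesis using Fc[of i] G(2)[of i] by simp
  next
    case False
    hence "coeff (F + G) i = 0" using d by (intro coeff_eq_0) simp
    thus ?thesis by simp
  qed
  fix z assume z: "poly (map_poly complex_of_int (F + G)) z = 0"
  have M1: "M \<ge> 1" using lead v(2) F by (cases M) (auto simp: eisenstein_polys_def odd_pairs_def coprime_pairs_def)
  show "norm z \<le> 80 * real n"
  proof (rule root_bound[OF _ n _ _ _ _ _ z])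
    show "degree (map_poly complex_of_int (F + G)) = n" using d by simp
    show "real M / 16 > 0" using M1 by simp
    have "real_of_int (int M) < real_of_int (16 * coeff (F + G) n)" using lead by (simp only: of_int_less_iff)
    moreover have "norm (coeff (map_poly complex_of_int (F + G)) n) = real_of_int \<bar>coeff (F + G) n\<bar>"
      by (simp only: of_int_hom.coeff_map_poly_hom norm_of_int)
    ultimately show "real M / 16 \<le> norm (coeff (map_poly complex_of_int (F + G)) n)"
      by (simp del: coeff_add)
    show "norm (coeff (map_poly complex_of_int (F + G)) i) \<le> 5 * real M" for i
    proof -
      have "real_of_int \<bar>coeff (F + G) i\<bar> \<le> real_of_int (5 * int M)" using c[of i] by (simp only: of_int_le_iff)
      thus ?thesis by (simp add: norm_of_int del: coeff_add)
    qed
    show "real n * (5 * real M) \<le> 80 * real n * (real M / 16)" by simp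
    show "80 * real n \<ge> 1" using n by simp
  qed
qed

text \<open>
  The constant coefficient is the only negative one, and at \<open>80 n\<close> it is outweighed by the leading term.
\<close>

lemma eisenstein_real_root:
  assumes F: "F \<in> eisenstein_polys n M" and n: "n \<ge> 1"
  obtains \<alpha> :: real where "0 \<le> \<alpha>" "\<alpha> \<le> 80 * real n" "poly (map_poly real_of_int F) \<alpha> = 0"
proof -
  obtain u v where uv: "u \<ge> 1" "u \<le> 2 * M" "M < 8 * v" and F0: "coeff F 0 = - 2 * int u"
    and Fn: "coeff F n = int v" and deg: "degree F = n"
    and mid: "\<And>i. 0 < i \<Longrightarrow> i < n \<Longrightarrow> even (coeff F i) \<and> 0 < coeff F i \<and> coeff F i \<le> 2 * int M"
    using eisenstein_polysE[OF F n] by metis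
  define B where "B = 80 * real n"
  have B: "B \<ge> 80" using n by (simp add: B_def)
  have eq: "poly (map_poly real_of_int F) x = (\<Sum>i\<le>n. real_of_int (coeff F i) * x ^ i)" for x
    by (simp add: poly_altdef deg)
  have "poly (map_poly real_of_int F) 0 = - 2 * real u" by (simp add: poly_0_coeff_0 F0)
  hence neg: "poly (map_poly real_of_int F) 0 < 0" using uv by simp
  have "(\<Sum>i\<in>{0, n}. real_of_int (coeff F i) * B ^ i) \<le> (\<Sum>i\<le>n. real_of_int (coeff F i) * B ^ i)"
  proof (intro sum_mono2)
    fix i assume "i \<in> {..n} - {0, n}"
    hence "0 < coeff F i" using mid[of i] by auto
    thus "0 \<le> real_of_int (coeff F i) * B ^ i" using B by (intro mult_nonneg_nonneg) auto
  qed auto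
  also have "(\<Sum>i\<in>{0, n}. real_of_int (coeff F i) * B ^ i) = - 2 * real u + real v * B ^ n"
    using n F0 Fn by simp
  finally have ge: "- 2 * real u + real v * B ^ n \<le> poly (map_poly real_of_int F) B" by (simp add: eq)
  have "real v * 80 \<le> real v * B ^ n"
    using self_le_power[of B n] B n by (intro mult_left_mono) auto
  moreover have "real M < 8 * real v" using uv(3) by linarith
  moreover have "real u \<le> 2 * real M" using uv(2) by linarith
  ultimately have pos: "0 < poly (map_poly real_of_int F) B" using ge by linarith
  have "0 < B" using B by simp
  from poly_IVT_pos[OF this neg pos] obtain \<alpha> where "0 < \<alpha>" "\<alpha> < B" "poly (map_poly real_of_int F) \<alpha> = 0"
    by blast
  with that[of \<alpha>] show thesis by (simp add: B_def)
qed

lemma poly_bound: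
  fixes p :: "int poly" and z :: complex
  assumes "degree p \<le> n" "\<And>i. i \<le> n \<Longrightarrow> \<bar>coeff p i\<bar> \<le> int N" "norm z \<le> B" "B \<ge> 1"
  shows "norm (poly (map_poly complex_of_int p) z) \<le> real (n + 1) * real N * B ^ n"
proof -
  have "poly (map_poly complex_of_int p) z = (\<Sum>i\<le>n. of_int (coeff p i) * z ^ i)"
    using assms(1) by (simp add: poly_altdef, intro sum.mono_neutral_left) (auto simp: coeff_eq_0)
  also have "norm \<dots> \<le> (\<Sum>i\<le>n. norm (of_int (coeff p i) * z ^ i))" by (rule norm_sum)
  also have "\<dots> \<le> (\<Sum>i\<le>n. real N * B ^ n)"
  proof (intro sum_mono)
    fix i assume i: "i \<in> {..n}"
    have "real_of_int \<bar>coeff p i\<bar> \<le> real_of_int (int N)" using assms(2)[of i] i by (simp only: of_int_le_iff atMost_iff)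
    moreover have "norm z ^ i \<le> B ^ i" using assms(3) by (intro power_mono) auto
    moreover have "B ^ i \<le> B ^ n" using assms(4) i by (intro power_increasing) auto
    ultimately show "norm (of_int (coeff p i) * z ^ i) \<le> real N * B ^ n"
      unfolding norm_mult norm_power norm_of_int by (intro mult_mono) auto
  qed
  finally show ?thesis by (simp add: mult.assoc)
qed

lemma poly_complex_of_real:
  "poly (map_poly complex_of_int p) (complex_of_real x) = complex_of_real (poly (map_poly real_of_int p) x)"
  by (induction p) (auto simp: map_poly_pCons)

definition small_polys :: "nat \<Rightarrow> nat \<Rightarrow> real \<Rightarrow> real \<Rightarrow> int poly set" where
  "small_polys n N \<delta> \<alpha> = {G. G \<noteq> 0 \<and> degree G \<le> n \<and> (\<forall>i\<le>n. \<bar>coeff G i\<bar> \<le> int N) \<and>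
     \<bar>poly (map_poly real_of_int G) \<alpha>\<bar> \<le> \<delta>}"

lemma finite_small_polys: "finite (small_polys n N \<delta> \<alpha>)"
proof (rule finite_subset)
  show "small_polys n N \<delta> \<alpha> \<subseteq> poly_box n (\<lambda>_. {- int N..int N})"
  proof
    fix G assume "G \<in> small_polys n N \<delta> \<alpha>"
    hence G: "degree G \<le> n" "\<And>i. i \<le> n \<Longrightarrow> \<bar>coeff G i\<bar> \<le> int N"
      by (auto simp: small_polys_def)
    have "coeff G i \<in> {- int N..int N}" if "i \<le> n" for i
      using G(2)[OF that] by (simp add: abs_le_iff)
    with G(1) show "G \<in> poly_box n (\<lambda>_. {- int N..int N})" by (simp add: poly_box_def)
  qed
  show "finite (poly_box n (\<lambda>_. {- int N..int N}))" by (rule finite_poly_box) simp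
qed

text \<open>
  Pigeonhole: the polynomials with coefficients in \<open>{0..N}\<close> take values at \<open>\<alpha>\<close> in an interval of length
  \<open>(n + 1) (N + 1) B ^ n\<close>. Cut it into \<open>L\<close> pieces and subtract a fixed polynomial of the fullest piece
  from all the others in it.
\<close>

lemma card_small_polys:
  assumes \<alpha>: "0 \<le> \<alpha>" "\<alpha> \<le> B" "B \<ge> 1" and L: "L \<ge> 1"
  shows "(N + 1) ^ (n + 1) \<le>
    L * (card (small_polys n N (real (n + 1) * real (N + 1) * B ^ n / real L) \<alpha>) + 1)"
proof -
  define W where "W = real (n + 1) * real (N + 1) * B ^ n"
  let ?v = "\<lambda>p. poly (map_poly real_of_int p) \<alpha>" and ?G = "small_polys n N (W / real L) \<alpha>"
  define S where "S = poly_box n (\<lambda>_. {0..int N})"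
  \<comment> \<open>The number of the piece that contains the value at \<open>\<alpha>\<close>.\<close>
  define \<phi> where "\<phi> p = nat \<lfloor>?v p * real L / W\<rfloor>" for p
  have W: "W > 0" using \<alpha> unfolding W_def by (intro mult_pos_pos) auto
  have v: "0 \<le> ?v p \<and> ?v p < W" if "p \<in> S" for p
  proof -
    have c: "degree p \<le> n" "\<And>i. i \<le> n \<Longrightarrow> 0 \<le> coeff p i \<and> coeff p i \<le> int N"
      using that by (auto simp: S_def poly_box_def)
    have eq: "?v p = (\<Sum>i\<le>n. real_of_int (coeff p i) * \<alpha> ^ i)"
      using c(1) by (simp add: poly_altdef, intro sum.mono_neutral_left) (auto simp: coeff_eq_0)
    have "?v p \<ge> 0" unfolding eq using c(2) \<alpha> by (intro sum_nonneg mult_nonneg_nonneg) auto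
    have "\<bar>?v p\<bar> \<le> real (n + 1) * real N * B ^ n"
      using poly_bound[of p n N "complex_of_real \<alpha>" B] c \<alpha> 
      unfolding poly_complex_of_real by (simp add: norm_of_real)
    also have "\<dots> < W" unfolding W_def using \<alpha> by simp
    finally show ?thesis using \<open>?v p \<ge> 0\<close> by simp
  qed
  have \<phi>: "\<phi> p < L" if "p \<in> S" for p
  proof -
    have "?v p * real L / W < real L" using v[OF that] W L by (simp add: field_simps)
    hence "\<lfloor>?v p * real L / W\<rfloor> < int L" by (simp add: floor_less_iff)
    moreover have "0 \<le> \<lfloor>?v p * real L / W\<rfloor>" using v[OF that] W by simp
    ultimately show ?thesis unfolding \<phi>_def by linarith
  qed
  have fib: "card {p \<in> S. \<phi> p = k} \<le> card ?G + 1" for k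
  proof (cases "{p \<in> S. \<phi> p = k} = {}")
    case False
    then obtain q where q: "q \<in> S" "\<phi> q = k" by blast
    have "(\<lambda>p. p - q) ` {p \<in> S. \<phi> p = k} \<subseteq> insert 0 ?G"
    proof
      fix r assume "r \<in> (\<lambda>p. p - q) ` {p \<in> S. \<phi> p = k}"
      then obtain p where r: "r = p - q" and p: "p \<in> S" "\<phi> p = \<phi> q" using q(2) by auto
      have "degree r \<le> n" unfolding r using p(1) q(1) by (intro degree_diff_le) (auto simp: S_def poly_box_def)
      moreover have "\<bar>coeff r i\<bar> \<le> int N" if "i \<le> n" for i
      proof -
        have "coeff p i \<in> {0..int N}" "coeff q i \<in> {0..int N}"
          using p(1) q(1) that by (auto simp: S_def poly_box_def)
        thus ?thesis unfolding r by auto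
      qed
      moreover have "\<bar>?v r\<bar> \<le> W / real L"
      proof -
        have "0 \<le> ?v p * real L / W" "0 \<le> ?v q * real L / W" using v[OF p(1)] v[OF q(1)] W by simp_all
        hence "\<lfloor>?v p * real L / W\<rfloor> = \<lfloor>?v q * real L / W\<rfloor>"
          using p(2) unfolding \<phi>_def by (simp add: eq_nat_nat_iff)
        hence "\<bar>?v p * real L / W - ?v q * real L / W\<bar> \<le> 1"
          using floor_correct[of "?v p * real L / W"] floor_correct[of "?v q * real L / W"] by linarith
        also have "?v p * real L / W - ?v q * real L / W = ?v r * (real L / W)"
          unfolding r by (simp add: hom_distribs algebra_simps)
        finally have "\<bar>?v r\<bar> * (real L / W) \<le> 1" using W by (simp add: abs_mult)
        thus ?thesis using W L by (simp add: field_simps)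
      qed
      ultimately show "r \<in> insert 0 ?G" by (auto simp: small_polys_def)
    qed
    hence "card ((\<lambda>p. p - q) ` {p \<in> S. \<phi> p = k}) \<le> card (insert 0 ?G)"
      by (intro card_mono) (simp_all add: finite_small_polys)
    also have "\<dots> \<le> card ?G + 1" using card_insert_le_m1[of "card ?G + 1" ?G 0] by simp
    finally show ?thesis by (simp add: card_image inj_on_def)
  next
    case True
    show ?thesis unfolding True by simp
  qed
  have "S = (\<Union>k\<in>{..<L}. {p \<in> S. \<phi> p = k})" using \<phi> by auto
  hence "card S \<le> (\<Sum>k<L. card {p \<in> S. \<phi> p = k})" by (metis card_UN_le finite_lessThan)
  also have "\<dots> \<le> (\<Sum>k<L. card ?G + 1)" by (intro sum_mono fib)
  finally have "card S \<le> L * (card ?G + 1)" by simp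
  moreover have "card {0..int N} = N + 1" by simp
  hence "card S = (N + 1) ^ (n + 1)" unfolding S_def card_poly_box by (simp only: prod_constant card_atMost Suc_eq_plus1)
  ultimately show ?thesis by (simp only: W_def)
qed

section \<open>Resultants of perturbed polynomials and matrices with a distant pole\<close>

lemma norm_prod_mset_le:
  fixes h :: "complex \<Rightarrow> complex"
  assumes "\<And>\<beta>. \<beta> \<in># A \<Longrightarrow> norm (h \<beta>) \<le> K"
  shows "norm (\<Prod>\<beta>\<in>#A. h \<beta>) \<le> K ^ size A"
  using assms
proof (induction A)
  case (add \<beta> A)
  have "norm (h \<beta>) \<le> K" "norm (\<Prod>\<beta>\<in>#A. h \<beta>) \<le> K ^ size A" using add by simp_all
  moreover from this(1) have "K \<ge> 0" using norm_ge_zero order_trans by blast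
  ultimately show ?case by (simp add: norm_mult mult_mono)
qed simp

text \<open>
  At the roots of \<open>F\<close> the polynomials \<open>F + G\<close> and \<open>G\<close> agree, so the resultant is a power of the leading
  coefficient times the product of the values of \<open>G\<close>. The value at \<open>\<alpha>\<close> contributes \<open>\<delta>\<close>, and the
  other \<open>n - 1\<close> roots are bounded.
\<close>

lemma resultant_perturbed_le:
  assumes F: "F \<in> eisenstein_polys n M" and n: "n \<ge> 1" and N: "16 * N \<le> M"
    and \<alpha>: "poly (map_poly real_of_int F) \<alpha> = 0" and G: "G \<in> small_polys n N \<delta> \<alpha>"
  shows "real_of_int \<bar>resultant (F + G) F\<bar> \<le>
    (2 * real M) ^ n * (\<delta> * (real (n + 1) * real N * (80 * real n) ^ n) ^ (n - 1))"
proof -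
  let ?c = "map_poly complex_of_int" and ?K = "real (n + 1) * real N * (80 * real n) ^ n"
  obtain u v where v: "v \<le> 2 * M" and Fn: "coeff F n = int v" and deg: "degree F = n" "F \<noteq> 0"
    using eisenstein_polysE[OF F n] by metis
  have Gs: "degree G \<le> n" "\<And>i. i \<le> n \<Longrightarrow> \<bar>coeff G i\<bar> \<le> int N"
    and G\<alpha>: "\<bar>poly (map_poly real_of_int G) \<alpha>\<bar> \<le> \<delta>"
    using G by (auto simp: small_polys_def)
  have "16 * \<bar>coeff G i\<bar> \<le> int M" if "i \<le> n" for i using Gs(2)[OF that] N by linarith
  note FG = perturbed_roots[OF F n Gs(1) this]
  have roots: "norm \<beta> \<le> 80 * real n" if "poly (?c F) \<beta> = 0" for \<beta>
    using perturbed_roots(4)[OF F n, of 0] that by simp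
  have nz: "?c F \<noteq> 0" "?c (F + G) \<noteq> 0" using deg FG by simp_all
  have "poly (?c F) (complex_of_real \<alpha>) = 0" unfolding poly_complex_of_real \<alpha> by simp
  hence "complex_of_real \<alpha> \<in># proots (?c F)" using nz by simp
  then obtain A where A: "proots (?c F) = add_mset (complex_of_real \<alpha>) A" by (metis insert_DiffM)
  have "size (proots (?c F)) = n" using poly_conv_proots(2)[OF nz(1)] deg by simp
  hence sz: "size A = n - 1" using A by simp
  have val: "poly (?c (F + G)) \<beta> = poly (?c G) \<beta>" if "\<beta> \<in># proots (?c F)" for \<beta>
    using that nz by (simp add: hom_distribs)
  have "complex_of_int (resultant (F + G) F) = resultant (?c (F + G)) (?c F)"
    by (rule of_int_hom.resultant_hom[symmetric])
  also have "\<dots> = (-1) ^ (n * n) * of_int (coeff F n) ^ n * (\<Prod>\<beta>\<in>#proots (?c F). poly (?c (F + G)) \<beta>)"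
    unfolding resultant_conv_roots_complex[OF nz(2,1)] roots_resultant_eval[OF nz(2,1)]
    using deg FG(1) by simp
  also have "(\<Prod>\<beta>\<in>#proots (?c F). poly (?c (F + G)) \<beta>) = (\<Prod>\<beta>\<in>#proots (?c F). poly (?c G) \<beta>)"
    by (intro arg_cong[of _ _ prod_mset] image_mset_cong val)
  finally have "norm (complex_of_int (resultant (F + G) F)) =
      real v ^ n * (norm (poly (?c G) (complex_of_real \<alpha>)) * norm (\<Prod>\<beta>\<in>#A. poly (?c G) \<beta>))"
    unfolding A Fn by (simp add: norm_mult norm_power)
  also have "\<dots> \<le> (2 * real M) ^ n * (\<delta> * ?K ^ (n - 1))"
  proof (intro mult_mono power_mono)
    show "norm (poly (?c G) (complex_of_real \<alpha>)) \<le> \<delta>"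
      using G\<alpha> unfolding poly_complex_of_real by (simp only: norm_of_real)
    have "norm (poly (?c G) \<beta>) \<le> ?K" if "\<beta> \<in># A" for \<beta>
    proof (rule poly_bound[OF Gs])
      have "\<beta> \<in># proots (?c F)" using A that by simp
      thus "norm \<beta> \<le> 80 * real n" using nz by (intro roots) simp
    qed (use n in auto)
    from norm_prod_mset_le[of A, OF this] show "norm (\<Prod>\<beta>\<in>#A. poly (?c G) \<beta>) \<le> ?K ^ (n - 1)"
      by (simp add: sz)
    show "real v \<le> 2 * real M" using v by linarith
    show "0 \<le> \<delta>" using G\<alpha> by linarith
  qed auto
  finally show ?thesis by (simp add: norm_of_int)
qed

lemma nonneg_coeffs_mult:
  fixes p q :: "int poly"
  assumes "\<And>i. coeff p i \<ge> 0" "\<And>i. coeff q i \<ge> 0"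
  shows "coeff (p * q) i \<ge> 0"
  using assms by (simp add: coeff_mult sum_nonneg)

lemma nonneg_coeffs_power:
  fixes p :: "int poly"
  assumes "\<And>i. coeff p i \<ge> 0"
  shows "coeff (p ^ k) i \<ge> 0"
  by (induction k arbitrary: i) (use assms in \<open>auto intro: nonneg_coeffs_mult\<close>)

text \<open>
  With nonnegative coefficients the value at 1 is the sum of all coefficients. This bounds the coefficients
  of products of powers of linear forms without binomial expansions.
\<close>

lemma coeff_le_poly_1:
  fixes p :: "int poly"
  assumes "\<And>i. coeff p i \<ge> 0"
  shows "coeff p i \<le> poly p 1"
proof (cases "i \<le> degree p")
  case True
  thus ?thesis using assms member_le_sum[of i "{..degree p}" "coeff p"] by (simp add: poly_altdef)
next
  case False
  thus ?thesis using assms by (simp add: coeff_eq_0 poly_altdef sum_nonneg)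
qed

lemma moebius_coeff_bound:
  fixes f :: "int poly"
  assumes "\<And>i. \<bar>coeff f i\<bar> \<le> H" "0 \<le> a" "0 \<le> b" "0 \<le> c" "0 \<le> d" "a + b \<le> A" "c + d \<le> A"
  shows "\<bar>coeff (moebius a b c d n f) k\<bar> \<le> int (n + 1) * H * A ^ n"
proof -
  let ?q = "\<lambda>i. [:b, a:] ^ i * [:d, c:] ^ (n - i)"
  have nn: "coeff (?q i) k \<ge> 0" for i k
    using assms by (intro nonneg_coeffs_mult nonneg_coeffs_power) (auto simp: coeff_pCons split: nat.splits)
  have le: "coeff (?q i) k \<le> A ^ n" if "i \<le> n" for i
  proof -
    have "coeff (?q i) k \<le> poly (?q i) 1" by (rule coeff_le_poly_1[OF nn])
    also have "\<dots> = (a + b) ^ i * (c + d) ^ (n - i)" by (simp add: add.commute)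
    also have "\<dots> \<le> A ^ i * A ^ (n - i)" using assms by (intro mult_mono power_mono) auto
    also have "\<dots> = A ^ n" using that by (simp flip: power_add)
    finally show ?thesis .
  qed
  have "coeff (moebius a b c d n f) k = (\<Sum>i\<le>n. coeff f i * coeff (?q i) k)"
    by (simp add: moebius_def coeff_sum)
  also have "\<bar>\<dots>\<bar> \<le> (\<Sum>i\<le>n. \<bar>coeff f i * coeff (?q i) k\<bar>)" by (rule sum_abs)
  also have "\<dots> \<le> (\<Sum>i\<le>n. H * A ^ n)"
  proof (intro sum_mono)
    fix i assume "i \<in> {..n}"
    thus "\<bar>coeff f i * coeff (?q i) k\<bar> \<le> H * A ^ n"
      unfolding abs_mult using le[of i] nn[of i k] assms(1)[of i] abs_ge_zero[of "coeff f i"]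
      by (intro mult_mono) auto
  qed
  finally show ?thesis by (simp add: algebra_simps)
qed

lemma poly_height_le_iff: "poly_height P \<le> h \<longleftrightarrow> (\<forall>i\<le>degree P. \<bar>coeff P i\<bar> \<le> h)"
  unfolding poly_height_def by (subst Max_le_iff) auto

definition tame :: "nat \<Rightarrow> int poly \<Rightarrow> bool" where
  "tame n f \<longleftrightarrow> degree f = n \<and> f \<noteq> 0 \<and>
     (\<forall>z. poly (map_poly complex_of_int f) z = 0 \<longrightarrow> norm z \<le> 80 * real n)"

text \<open>
  Completions \<open>(a, b)\<close> of the row \<open>(c, d)\<close> to a matrix of determinant 1 with \<open>a\<close> so large that
  \<open>a - c \<beta>\<close> stays at distance at least \<open>3 T\<close> from 0 whenever \<open>norm \<beta> \<le> 80 n\<close>.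
\<close>

definition far_unimodular :: "nat \<Rightarrow> nat \<Rightarrow> nat \<times> nat \<Rightarrow> int \<times> int \<Rightarrow> bool" where
  "far_unimodular n T = (\<lambda>(c, d) (a, b). (c, d) \<in> coprime_pairs T \<and> d \<le> c \<and> a * int d - b * int c = 1 \<and>
     int ((80 * n + 3) * T) \<le> a \<and> a \<le> int ((80 * n + 4) * T) \<and> 0 \<le> b \<and> b \<le> int ((80 * n + 4) * T))"

lemma far_pole:
  assumes "far_unimodular n T (c, d) (a, b)" "norm \<beta> \<le> 80 * real n"
  shows "3 * real T \<le> norm (complex_of_int a - complex_of_nat c * \<beta>)"
proof -
  have c: "c \<le> T" and a: "int ((80 * n + 3) * T) \<le> a"
    using assms(1) by (auto simp: far_unimodular_def coprime_pairs_def)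
  have "real_of_int (int ((80 * n + 3) * T)) \<le> real_of_int a" using a by (simp only: of_int_le_iff)
  hence "real (80 * n + 3) * real T \<le> real_of_int a" by (metis of_int_of_nat_eq of_nat_mult)
  moreover have "norm (complex_of_nat c * \<beta>) \<le> real T * (80 * real n)"
    unfolding norm_mult norm_of_nat using assms(2) c by (intro mult_mono) auto
  moreover have "norm (complex_of_int a) - norm (complex_of_nat c * \<beta>) \<le>
      norm (complex_of_int a - complex_of_nat c * \<beta>)"
    by (rule norm_triangle_ineq2)
  moreover have "real_of_int a \<le> norm (complex_of_int a)" by (simp add: norm_of_int)
  ultimately show "3 * real T \<le> norm (complex_of_int a - complex_of_nat c * \<beta>)"
    by (simp add: algebra_simps)
qed

text \<open>
  A root \<open>x\<close> of the transform comes from a root \<open>\<beta>\<close> of \<open>f\<close> with \<open>c x + d = 1 / (a - c \<beta>)\<close>, so \<open>x\<close> is an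
  unusually good approximation to \<open>- d / c\<close>.
\<close>

lemma far_moebius_roots:
  fixes f :: "int poly"
  assumes g: "far_unimodular n T (c, d) (a, b)" and tame: "tame n f"
  shows "degree (moebius a b (int c) (int d) n f) = n" "moebius a b (int c) (int d) n f \<noteq> 0"
    and "\<And>x. poly (map_poly complex_of_int (moebius a b (int c) (int d) n f)) x = 0 \<Longrightarrow>
           norm (complex_of_nat c * x + complex_of_nat d) \<le> 1 / (3 * real T)"
    and "\<forall>\<beta>\<in>#proots (map_poly complex_of_int f). of_int a - of_nat c * \<beta> \<noteq> 0"
proof -
  let ?f = "map_poly complex_of_int f" and ?m = "moebius a b (int c) (int d) n f"
  have f: "degree f = n" "f \<noteq> 0" and roots: "\<And>z. poly ?f z = 0 \<Longrightarrow> norm z \<le> 80 * real n"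
    using tame by (auto simp: tame_def)
  have nz: "?f \<noteq> 0" using f by simp
  have det: "complex_of_int a * of_nat d - of_int b * of_nat c = 1"
  proof -
    have "a * int d - b * int c = 1" using g by (simp add: far_unimodular_def)
    hence "complex_of_int (a * int d - b * int c) = 1" by (simp only: of_int_1)
    thus ?thesis by simp
  qed
  have T: "T \<ge> 1" using g by (auto simp: far_unimodular_def coprime_pairs_def)
  have far: "3 * real T \<le> norm (of_int a - of_nat c * \<beta>)" if "\<beta> \<in># proots ?f" for \<beta>
    using far_pole[OF g roots] that nz by simp
  show pole: "\<forall>\<beta>\<in>#proots ?f. of_int a - of_nat c * \<beta> \<noteq> 0"
  proof
    fix \<beta> assume "\<beta> \<in># proots ?f"
    from far[OF this] T show "of_int a - of_nat c * \<beta> \<noteq> 0" by auto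
  qed
  have cd: "complex_of_nat c \<noteq> 0 \<or> complex_of_nat d \<noteq> 0"
    using g by (auto simp: far_unimodular_def coprime_pairs_def)
  have m: "map_poly complex_of_int ?m = moebius (of_int a) (of_int b) (of_nat c) (of_nat d) n ?f"
    by (simp add: moebius_of_int)
  have fn: "degree ?f = n" using f by simp
  note R = moebius_roots[OF nz cd pole, of "of_int b", unfolded fn, folded m]
  show "degree ?m = n" using R(1) by simp
  show mz: "?m \<noteq> 0" using R(4) by auto
  fix x assume "poly (map_poly complex_of_int ?m) x = 0"
  hence "x \<in># proots (map_poly complex_of_int ?m)" using R(4) by simp
  then obtain \<beta> where \<beta>: "\<beta> \<in># proots ?f" and x: "x = (of_nat d * \<beta> - of_int b) / (of_int a - of_nat c * \<beta>)"
    unfolding R(3) by auto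
  have "complex_of_nat c * x + of_nat d = 1 / (of_int a - of_nat c * \<beta>)"
    unfolding x using moebius_inverse(1)[OF det] pole \<beta> by blast
  hence "norm (complex_of_nat c * x + of_nat d) = 1 / norm (of_int a - of_nat c * \<beta>)"
    by (simp add: norm_divide)
  also have "\<dots> \<le> 1 / (3 * real T)" using far[OF \<beta>] T by (intro divide_left_mono mult_pos_pos) auto
  finally show "norm (complex_of_nat c * x + of_nat d) \<le> 1 / (3 * real T)" .
qed

text \<open>
  If \<open>c x + d\<close> and \<open>c' x + d'\<close> are both at most \<open>1 / (3 T)\<close>, then eliminating \<open>x\<close> shows that the integer
  \<open>c' d - c d'\<close> is at most \<open>2 / 3\<close> in absolute value, hence 0.
\<close>

lemma far_unimodular_unique:
  fixes f f' :: "int poly"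
  assumes n: "n \<ge> 1" and g: "far_unimodular n T (c, d) (a, b)" "far_unimodular n T (c', d') (a', b')"
    and f: "tame n f" and f': "tame n f'"
    and eq: "moebius a b (int c) (int d) n f = moebius a' b' (int c') (int d') n f'"
  shows "(c, d) = (c', d')"
proof -
  let ?P = "map_poly complex_of_int (moebius a b (int c) (int d) n f)"
  note R = far_moebius_roots[OF g(1) f] and R' = far_moebius_roots[OF g(2) f', folded eq]
  have p: "c \<le> T" "c' \<le> T" "coprime c d" "coprime c' d'" "T \<ge> 1"
    using g by (auto simp: far_unimodular_def coprime_pairs_def)
  have "degree ?P \<noteq> 0" using R(1) n by simp
  hence "\<not> constant (poly ?P)" by (simp add: constant_degree)
  then obtain x where x: "poly ?P x = 0" using fundamental_theorem_of_algebra by blast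
  let ?s = "complex_of_nat c * x + complex_of_nat d" and ?s' = "complex_of_nat c' * x + complex_of_nat d'"
  have "complex_of_int (int c' * int d - int c * int d') = of_nat c' * ?s - of_nat c * ?s'"
    by (simp add: algebra_simps)
  also have "norm \<dots> \<le> norm (of_nat c' * ?s) + norm (of_nat c * ?s')" by (rule norm_triangle_ineq4)
  also have "\<dots> = real c' * norm ?s + real c * norm ?s'" by (simp only: norm_mult norm_of_nat)
  also have "\<dots> \<le> real T * (1 / (3 * real T)) + real T * (1 / (3 * real T))"
    using R(3)[OF x] R'(3)[OF x] p by (intro add_mono mult_mono) auto
  also have "\<dots> < 1" using p by simp
  finally have "\<bar>int c' * int d - int c * int d'\<bar> < 1"
    by (simp only: norm_of_int)
  hence "int c' * int d = int c * int d'" by linarith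
  hence "c' * d = c * d'" by (metis of_nat_eq_iff of_nat_mult)
  with p(3,4) show ?thesis by (metis coprime_commute coprime_crossproduct_nat mult.commute Pair_inject)
qed

section \<open>The number of pairs for given parameters\<close>

lemma perturbed_tame:
  assumes "F \<in> eisenstein_polys n M" "n \<ge> 1" "degree G \<le> n" "\<And>i. i \<le> n \<Longrightarrow> 16 * \<bar>coeff G i\<bar> \<le> int M"
  shows "tame n (F + G)"
  unfolding tame_def using perturbed_roots[OF assms] by blast

lemma far_det:
  assumes "far_unimodular n T (c, d) (a, b)"
  shows "complex_of_int a * of_int (int d) - of_int b * of_int (int c) = 1"
proof -
  have "a * int d - b * int c = 1" using assms by (simp add: far_unimodular_def)
  hence "complex_of_int (a * int d - b * int c) = 1" by (simp only: of_int_1)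
  thus ?thesis by (simp only: of_int_diff of_int_mult)
qed

lemma far_moebius_inject:
  assumes "far_unimodular n T (c, d) (a, b)" "degree f \<le> n" "degree g \<le> n"
    and "moebius a b (int c) (int d) n f = moebius a b (int c) (int d) n g"
  shows "f = g"
proof -
  have "map_poly complex_of_int f = map_poly complex_of_int g"
  proof (rule moebius_inject[OF far_det[OF assms(1)]])
    show "degree (map_poly complex_of_int f) \<le> n" "degree (map_poly complex_of_int g) \<le> n"
      using assms(2,3) by simp_all
  qed (simp only: moebius_of_int[symmetric] assms(4))
  thus ?thesis by simp
qed

lemma resultant_far_moebius:
  assumes g: "far_unimodular n T (c, d) (a, b)" and p: "tame n p" and q: "tame n q"
  shows "resultant (moebius a b (int c) (int d) n p) (moebius a b (int c) (int d) n q) = resultant p q"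
proof -
  let ?c = "map_poly complex_of_int" and ?m = "moebius a b (int c) (int d) n"
  have "complex_of_int (resultant (?m p) (?m q)) = resultant (?c (?m p)) (?c (?m q))"
    by (rule of_int_hom.resultant_hom[symmetric])
  also have "\<dots> = resultant (?c p) (?c q)"
    unfolding moebius_of_int
    using p q far_moebius_roots(4)[OF g p] far_moebius_roots(4)[OF g q]
    by (intro resultant_moebius[OF far_det[OF g]]) (simp_all add: tame_def)
  also have "\<dots> = complex_of_int (resultant p q)" by (rule of_int_hom.resultant_hom)
  finally show ?thesis by simp
qed

definition height_const :: "nat \<Rightarrow> nat" where
  "height_const n = 5 * (n + 1) * (2 * (80 * n + 4)) ^ n"

definition resultant_const :: "nat \<Rightarrow> real" where
  "resultant_const n = (4 * (real (n + 1) * (80 * real n) ^ n)) ^ n"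

definition count_const :: "nat \<Rightarrow> real" where
  "count_const n = 384 * 16 ^ (n + 1)"

lemma far_moebius_bounded:
  assumes g: "far_unimodular n T (c, d) (a, b)" and f: "tame n f" "\<And>i. \<bar>coeff f i\<bar> \<le> 5 * int M"
    and Q: "real (height_const n) * real M * real T ^ n \<le> Q"
  shows "moebius a b (int c) (int d) n f \<in> bounded_polys n Q"
proof -
  let ?A = "2 * int ((80 * n + 4) * T)" and ?m = "moebius a b (int c) (int d) n f"
  have "T \<le> (80 * n + 4) * T" by simp
  moreover have "c \<le> T" "d \<le> T" using g by (auto simp: far_unimodular_def coprime_pairs_def)
  ultimately have "int c + int d \<le> ?A" by linarith
  moreover have "int ((80 * n + 3) * T) \<le> a" "a \<le> int ((80 * n + 4) * T)" "0 \<le> b" "b \<le> int ((80 * n + 4) * T)"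
    using g by (simp_all only: far_unimodular_def prod.case)
  hence "0 \<le> a" "0 \<le> b" "a + b \<le> ?A" by linarith+
  ultimately have "\<bar>coeff ?m k\<bar> \<le> int (n + 1) * (5 * int M) * ?A ^ n" for k
    by (intro moebius_coeff_bound f(2)) auto
  also have "int (n + 1) * (5 * int M) * ?A ^ n = int (height_const n * M * T ^ n)"
  proof -
    have "?A = int (2 * (80 * n + 4)) * int T" by simp
    hence "?A ^ n = int (2 * (80 * n + 4)) ^ n * int T ^ n" by (simp only: power_mult_distrib)
    thus ?thesis unfolding height_const_def by (simp only: of_nat_mult of_nat_power of_nat_numeral mult_ac)
  qed
  finally have "poly_height ?m \<le> int (height_const n * M * T ^ n)"
    by (simp only: poly_height_le_iff) blast
  hence "real_of_int (poly_height ?m) \<le> real_of_int (int (height_const n * M * T ^ n))"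
    by (simp only: of_int_le_iff)
  also have "\<dots> \<le> Q" using Q by simp
  finally show ?thesis using far_moebius_roots(1)[OF g f(1)] by (simp add: bounded_polys_def)
qed

text \<open>
  The condition on \<open>L\<close> makes the pigeonhole bound at least 2, so that discarding the zero polynomial
  costs at most half of it.
\<close>

lemma perturbation_count:
  assumes n: "n \<ge> 1" and L: "L \<ge> 1" and big: "2 * 16 ^ (n + 1) * L \<le> M ^ (n + 1)"
    and \<alpha>: "0 \<le> \<alpha>" "\<alpha> \<le> 80 * real n" and N: "N = M div 16"
  shows "real M ^ (n + 1) \<le> 2 * 16 ^ (n + 1) * real L *
    real (card (small_polys n N (real (n + 1) * real (N + 1) * (80 * real n) ^ n / real L) \<alpha>))"
proof -
  let ?k = "card (small_polys n N (real (n + 1) * real (N + 1) * (80 * real n) ^ n / real L) \<alpha>)"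
  have "80 * real n \<ge> 1" using n by simp
  from card_small_polys[OF \<alpha> this L, of N n]
  have count: "(N + 1) ^ (n + 1) \<le> L * (?k + 1)" .
  have "M \<le> 16 * (N + 1)" unfolding N by simp
  hence "M ^ (n + 1) \<le> (16 * (N + 1)) ^ (n + 1)" by (intro power_mono) simp_all
  also have "\<dots> = 16 ^ (n + 1) * (N + 1) ^ (n + 1)" by (rule power_mult_distrib)
  also have "\<dots> \<le> 16 ^ (n + 1) * (L * (?k + 1))" using count by (intro mult_left_mono) simp_all
  finally have "2 * M ^ (n + 1) \<le> 2 * (16 ^ (n + 1) * L * ?k) + 2 * 16 ^ (n + 1) * L"
    by (simp add: algebra_simps)
  hence "M ^ (n + 1) \<le> 2 * 16 ^ (n + 1) * L * ?k" using big by linarith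
  hence "real (M ^ (n + 1)) \<le> real (2 * 16 ^ (n + 1) * L * ?k)" by (simp only: of_nat_le_iff)
  thus ?thesis by simp
qed

text \<open>
  The pairs are \<open>(F + G, F)\<close>, transformed by one matrix for every coprime pair \<open>d \<le> c \<le> T\<close>. The map from
  \<open>((c, d), F, G)\<close> to the transformed pair is injective: a root of the second component reveals \<open>(c, d)\<close>
  and so the matrix, which can then be undone.
\<close>

lemma resultant_pairs_count:
  fixes Q \<rho> w :: real
  assumes n: "n \<ge> 1" and T: "T \<ge> 1" and L: "L \<ge> 1" and big: "2 * 16 ^ (n + 1) * L \<le> M ^ (n + 1)"
    and Q: "real (height_const n) * real M * real T ^ n \<le> Q"
    and \<rho>: "resultant_const n * real M ^ (2 * n) / real L \<le> \<rho> * Q powr (2 * real n - 2 * w)"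
  shows "real T ^ 2 * real M ^ (2 * n + 2) \<le>
    count_const n * real L * real (card (resultant_pairs n \<rho> Q w))"
proof -
  define N where "N = M div 16"
  \<comment> \<open>The precision that \<open>L\<close> pigeonholes achieve for coefficients up to \<open>N\<close> on \<open>{0..80 n}\<close>.\<close>
  define \<delta> where "\<delta> = real (n + 1) * real (N + 1) * (80 * real n) ^ n / real L"
  define P where "P = {(c, d) \<in> coprime_pairs T. d \<le> c}"
  have N16: "16 * N \<le> M" by (simp add: N_def)
  have M1: "M \<ge> 1"
  proof (rule ccontr)
    assume "\<not> M \<ge> 1"
    hence "M = 0" by simp
    hence "2 * 16 ^ (n + 1) * L = 0" using big by simp
    with L show False by simp
  qed
  have "\<forall>p\<in>P. \<exists>ab. far_unimodular n T p ab"
  proof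
    fix p assume "p \<in> P"
    then obtain c d where p: "p = (c, d)" "(c, d) \<in> coprime_pairs T" "d \<le> c" by (auto simp: P_def)
    have "80 * n + 3 \<ge> 1" by simp
    from unimodular_completion[OF p(2,3) this] obtain a b where "a * int d - b * int c = 1"
      "int ((80 * n + 3) * T) \<le> a" "a \<le> int ((80 * n + 3 + 1) * T)" "0 \<le> b" "b \<le> int ((80 * n + 3 + 1) * T)"
      by blast
    moreover have "80 * n + 3 + 1 = 80 * n + 4" by simp
    ultimately have "far_unimodular n T (c, d) (a, b)"
      using p unfolding far_unimodular_def by (simp only: prod.case)
    thus "\<exists>ab. far_unimodular n T p ab" using p by blast
  qed
  then obtain \<gamma> where \<gamma>: "\<And>p. p \<in> P \<Longrightarrow> far_unimodular n T p (\<gamma> p)" by metis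
  have "\<forall>F\<in>eisenstein_polys n M. \<exists>\<alpha>. 0 \<le> \<alpha> \<and> \<alpha> \<le> 80 * real n \<and> poly (map_poly real_of_int F) \<alpha> = 0"
    using eisenstein_real_root[OF _ n] by blast
  then obtain \<alpha> where \<alpha>: "\<And>F. F \<in> eisenstein_polys n M \<Longrightarrow> 0 \<le> \<alpha> F \<and> \<alpha> F \<le> 80 * real n \<and>
      poly (map_poly real_of_int F) (\<alpha> F) = 0" by metis
  define S where "S F = small_polys n N \<delta> (\<alpha> F)" for F
  define mo where "mo p = moebius (fst (\<gamma> p)) (snd (\<gamma> p)) (int (fst p)) (int (snd p)) n" for p
  define \<Phi> where "\<Phi> = (\<lambda>(p, F, G). (mo p (F + G), mo p F))"
  define X where "X = P \<times> Sigma (eisenstein_polys n M) S"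
  have S: "G \<noteq> 0" "degree G \<le> n" "\<And>i. i \<le> n \<Longrightarrow> 16 * \<bar>coeff G i\<bar> \<le> int M" if "G \<in> S F" for F G
  proof -
    show "G \<noteq> 0" "degree G \<le> n" using that by (auto simp: S_def small_polys_def)
    fix i assume "i \<le> n"
    hence "\<bar>coeff G i\<bar> \<le> int N" using that by (auto simp: S_def small_polys_def)
    thus "16 * \<bar>coeff G i\<bar> \<le> int M" using N16 by linarith
  qed
  have tame: "tame n (F + G)" "tame n F" if "F \<in> eisenstein_polys n M" "G \<in> S F" for F G
    using perturbed_tame[OF that(1) n S(2,3)[OF that(2)]] perturbed_tame[OF that(1) n, of 0] by simp_all
  have far: "far_unimodular n T (fst p, snd p) (fst (\<gamma> p), snd (\<gamma> p))" if "p \<in> P" for p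
    using \<gamma>[OF that] by simp
  have inj: "inj_on \<Phi> X"
  proof (rule inj_onI)
    fix x y assume x: "x \<in> X" and y: "y \<in> X" and eq: "\<Phi> x = \<Phi> y"
    obtain p F G where xe: "x = (p, F, G)" by (cases x) auto
    obtain p' F' G' where ye: "y = (p', F', G')" by (cases y) auto
    have p: "p \<in> P" "p' \<in> P" and FG: "F \<in> eisenstein_polys n M" "G \<in> S F" "F' \<in> eisenstein_polys n M" "G' \<in> S F'"
      using x y by (auto simp: xe ye X_def)
    have e: "mo p (F + G) = mo p' (F' + G')" "mo p F = mo p' F'" using eq by (auto simp: xe ye \<Phi>_def)
    note t = tame[OF FG(1,2)] and t' = tame[OF FG(3,4)]
    have pp: "p = p'"
      using far_unimodular_unique[OF n far[OF p(1)] far[OF p(2)] t(2) t'(2)] e(2) by (simp add: mo_def)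
    have "F = F'"
      using far_moebius_inject[OF far[OF p(1)], of F F'] e(2) t(2) t'(2) pp by (simp add: mo_def tame_def)
    moreover have "F + G = F' + G'"
      using far_moebius_inject[OF far[OF p(1)], of "F + G" "F' + G'"] e(1) t(1) t'(1) pp
      by (simp add: mo_def tame_def)
    ultimately show "x = y" using pp xe ye by simp
  qed
  have res: "real_of_int \<bar>resultant (F + G) F\<bar> \<le> resultant_const n * real M ^ (2 * n) / real L"
    if "F \<in> eisenstein_polys n M" "G \<in> S F" for F G
  proof -
    let ?b = "(80 * real n) ^ n" let ?W = "real (n + 1) * (2 * real M) * ?b"
    have N1: "real (N + 1) \<le> 2 * real M" "real N \<le> 2 * real M" using N16 M1 by linarith+
    have "real_of_int \<bar>resultant (F + G) F\<bar> \<le>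
        (2 * real M) ^ n * (\<delta> * (real (n + 1) * real N * ?b) ^ (n - 1))"
      using resultant_perturbed_le[OF that(1) n N16 _ that(2)[unfolded S_def]] \<alpha>[OF that(1)] by blast
    also have "\<dots> \<le> (2 * real M) ^ n * (?W / real L * ?W ^ (n - 1))"
      unfolding \<delta>_def using N1
      by (intro mult_left_mono mult_mono divide_right_mono power_mono mult_right_mono) auto
    also have "\<dots> = (2 * real M) ^ n * ?W ^ n / real L"
      using power_minus_mult[of n ?W] n by (simp add: mult_ac)
    also have "(2 * real M) ^ n * ?W ^ n = resultant_const n * real M ^ (2 * n)"
    proof -
      have "(2 * real M) * ?W = (4 * (real (n + 1) * ?b)) * real M ^ 2" by (simp add: power2_eq_square)
      thus ?thesis
        unfolding resultant_const_def power_mult power_mult_distrib[symmetric] by (simp only: power_mult_distrib)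
    qed
    finally show ?thesis .
  qed
  have sub: "\<Phi> ` X \<subseteq> resultant_pairs n \<rho> Q w"
  proof
    fix z assume "z \<in> \<Phi> ` X"
    then obtain p F G where p: "p \<in> P" and FG: "F \<in> eisenstein_polys n M" "G \<in> S F"
      and z: "z = (mo p (F + G), mo p F)" by (auto simp: X_def \<Phi>_def)
    note t = tame[OF FG]
    have r: "resultant (mo p (F + G)) (mo p F) = resultant (F + G) F"
      unfolding mo_def by (rule resultant_far_moebius[OF far[OF p] t])
    have "resultant (F + G) F \<noteq> 0"
      by (rule resultant_perturbed_nonzero[OF FG(1) n S(1,2)[OF FG(2)]]) (use S(3)[OF FG(2)] in simp)
    moreover have "mo p (F + G) \<in> bounded_polys n Q" unfolding mo_def
      using perturbed_roots(3)[OF FG(1) n S(2,3)[OF FG(2)]] by (intro far_moebius_bounded[OF far[OF p] t(1) _ Q])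
    moreover have "mo p F \<in> bounded_polys n Q" unfolding mo_def
      using perturbed_roots(3)[OF FG(1) n, of 0] by (intro far_moebius_bounded[OF far[OF p] t(2) _ Q]) simp
    moreover have "real_of_int \<bar>resultant (F + G) F\<bar> \<le> \<rho> * Q powr (2 * real n - 2 * w)"
      using res[OF FG] \<rho> by linarith
    ultimately show "z \<in> resultant_pairs n \<rho> Q w" by (simp add: z resultant_pairs_def r)
  qed
  have "card X = card (\<Phi> ` X)" using card_image[OF inj] by simp
  also have "\<dots> \<le> card (resultant_pairs n \<rho> Q w)" by (rule card_mono[OF finite_resultant_pairs sub])
  finally have cX: "real (card X) \<le> real (card (resultant_pairs n \<rho> Q w))" by simp
  have finS: "finite (S F)" for F unfolding S_def by (rule finite_small_polys)
  let ?s = "\<Sum>F\<in>eisenstein_polys n M. real (card (S F))" and ?q = "2 * 16 ^ (n + 1) * real L"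
  have cardX: "real (card X) = real (card P) * ?s"
    by (simp add: X_def card_cartesian_product card_SigmaI finite_eisenstein_polys finS)
  have "(\<Sum>F\<in>eisenstein_polys n M. real M ^ (n + 1)) \<le> (\<Sum>F\<in>eisenstein_polys n M. ?q * real (card (S F)))"
  proof (intro sum_mono)
    fix F assume "F \<in> eisenstein_polys n M"
    with \<alpha> show "real M ^ (n + 1) \<le> ?q * real (card (S F))"
      unfolding S_def \<delta>_def by (intro perturbation_count[OF n L big _ _ N_def]) auto
  qed
  hence sumS: "real (card (eisenstein_polys n M)) * real M ^ (n + 1) \<le> ?q * ?s"
    by (simp add: sum_distrib_left)
  have "real T ^ 2 * real M ^ (2 * n + 2) = real T ^ 2 * (real M ^ (n + 1) * real M ^ (n + 1))"
    by (simp add: mult_2 flip: power_add)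
  also have "\<dots> \<le> (8 * real (card P)) * ((24 * real (card (eisenstein_polys n M))) * real M ^ (n + 1))"
    unfolding P_def by (intro mult_mono card_ordered_coprime_pairs card_eisenstein_polys[OF n]) auto
  also have "\<dots> = 192 * real (card P) * (real (card (eisenstein_polys n M)) * real M ^ (n + 1))" by simp
  also have "\<dots> \<le> 192 * real (card P) * (?q * ?s)" by (intro mult_left_mono sumS) simp
  also have "\<dots> = count_const n * real L * real (card X)"
    unfolding cardX count_const_def by simp
  also have "\<dots> \<le> count_const n * real L * real (card (resultant_pairs n \<rho> Q w))"
    using cX by (intro mult_left_mono) (auto simp: count_const_def)
  finally show ?thesis .
qed

section \<open>The two ranges of the exponent\<close>

lemma real_floor_ge_half:
  fixes x :: real
  assumes "x \<ge> 1"
  shows "real (nat \<lfloor>x\<rfloor>) \<le> x" "x / 2 \<le> real (nat \<lfloor>x\<rfloor>)"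
proof -
  have "\<lfloor>x\<rfloor> \<ge> 1" using assms by simp
  hence eq: "real (nat \<lfloor>x\<rfloor>) = real_of_int \<lfloor>x\<rfloor>" and one: "real_of_int \<lfloor>x\<rfloor> \<ge> 1" by simp_all
  show "real (nat \<lfloor>x\<rfloor>) \<le> x" unfolding eq by simp
  show "x / 2 \<le> real (nat \<lfloor>x\<rfloor>)" unfolding eq using one real_of_int_floor_add_one_gt[of x] by linarith
qed

lemma real_ceiling_bounds:
  fixes x :: real
  assumes "x > 0"
  shows "x \<le> real (nat \<lceil>x\<rceil>)" "real (nat \<lceil>x\<rceil>) \<le> x + 1" "nat \<lceil>x\<rceil> \<ge> 1"
proof -
  have "\<lceil>x\<rceil> \<ge> 1" using assms by (simp add: one_le_ceiling)
  hence eq: "real (nat \<lceil>x\<rceil>) = real_of_int \<lceil>x\<rceil>" by simp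
  show "x \<le> real (nat \<lceil>x\<rceil>)" unfolding eq by simp
  show "real (nat \<lceil>x\<rceil>) \<le> x + 1" unfolding eq using ceiling_correct[of x] by linarith
  show "nat \<lceil>x\<rceil> \<ge> 1" using \<open>\<lceil>x\<rceil> \<ge> 1\<close> by linarith
qed

lemma const_pos: "height_const n \<ge> 1" "n \<ge> 1 \<Longrightarrow> resultant_const n > 0" "count_const n > 0"
  by (simp_all add: height_const_def resultant_const_def count_const_def)

text \<open>
  Here \<open>T = 1\<close>, \<open>M\<close> is of order \<open>Q\<close> and \<open>L\<close> of order \<open>Q powr (2 * w)\<close>. The hypothesis on \<open>w\<close> says exactly
  that \<open>L\<close> does not exceed the order of \<open>M ^ (n + 1)\<close>.
\<close>

lemma small_w_count:
  assumes n: "n \<ge> 1"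
  shows "\<exists>\<rho>0>0. \<exists>C>0. \<exists>Q0>1. \<forall>\<rho>\<ge>\<rho>0. \<forall>Q\<ge>Q0. \<forall>w. 0 \<le> w \<and> w \<le> (real n + 1) / 2 \<longrightarrow>
    C * Q powr (2 * real n + 2 - 2 * w) \<le> real (card (resultant_pairs n \<rho> Q w))"
proof -
  define c where "c = real (height_const n)"
  \<comment> \<open>With \<open>M \<ge> Q / (2 c)\<close> this is the largest factor for which twice \<open>\<kappa> Q ^ (n + 1)\<close> pigeonholes
    are still few enough.\<close>
  define \<kappa> where "\<kappa> = 1 / (4 * (32 * c) ^ (n + 1))"
  define \<rho>0 where "\<rho>0 = resultant_const n / \<kappa>"
  define C where "C = 1 / ((2 * c) ^ (2 * n + 2) * 2 * count_const n)"
  define Q0 where "Q0 = 1 / \<kappa> + 1"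
  have c: "c \<ge> 1" unfolding c_def using const_pos(1)[of n] by linarith
  have p32: "c \<le> (32 * c) ^ (n + 1)" using c self_le_power[of "32 * c" "n + 1"] by simp
  have \<kappa>: "\<kappa> > 0" "1 / \<kappa> = 4 * (32 * c) ^ (n + 1)" using c by (simp_all add: \<kappa>_def)
  have "1 / X \<le> 1" if "X \<ge> 1" for X :: real using that by simp
  moreover have "4 * (32 * c) ^ (n + 1) \<ge> 1" using c p32 by linarith
  ultimately have \<kappa>1: "\<kappa> \<le> 1" unfolding \<kappa>_def by blast
  have "C * Q powr (2 * real n + 2 - 2 * w) \<le> real (card (resultant_pairs n \<rho> Q w))"
    if \<rho>: "\<rho> \<ge> \<rho>0" and Q: "Q \<ge> Q0" and w: "0 \<le> w" "w \<le> (real n + 1) / 2" for \<rho> Q w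
  proof -
    have "1 / \<kappa> > 0" using \<kappa>(1) by simp
    hence Q1: "Q > 1" using Q unfolding Q0_def by linarith
    have "c \<le> Q" using Q \<kappa>(2) p32 c unfolding Q0_def by linarith
    hence Qc: "Q / c \<ge> 1" using c by simp
    define M where "M = nat \<lfloor>Q / c\<rfloor>"
    define z where "z = Q powr (2 * w)"
    define L where "L = nat \<lceil>\<kappa> * z\<rceil>"
    note M = real_floor_ge_half[OF Qc, folded M_def]
    have z: "z \<ge> 1" "z \<le> Q ^ (n + 1)"
    proof -
      show "z \<ge> 1" unfolding z_def using Q1 w by (intro ge_one_powr_ge_zero) auto
      have "z \<le> Q powr real (n + 1)" unfolding z_def using Q1 w by (intro powr_mono) auto
      thus "z \<le> Q ^ (n + 1)" using Q1 by (simp add: powr_realpow del: of_nat_Suc of_nat_add)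
    qed
    have "\<kappa> * z > 0" using \<kappa> z by simp
    note L = real_ceiling_bounds[OF this, folded L_def]
    have big: "2 * 16 ^ (n + 1) * L \<le> M ^ (n + 1)"
    proof -
      have "1 \<le> \<kappa> * Q" using Q \<kappa>(1) by (simp add: Q0_def field_simps)
      also have "\<dots> \<le> \<kappa> * Q ^ (n + 1)" using \<kappa> Q1 self_le_power[of Q "n + 1"] by simp
      finally have "real L \<le> 2 * (\<kappa> * Q ^ (n + 1))"
        using L(2) mult_left_mono[OF z(2), of \<kappa>] \<kappa>(1) by linarith
      hence "2 * 16 ^ (n + 1) * real L \<le> 2 * 16 ^ (n + 1) * (2 * (\<kappa> * Q ^ (n + 1)))"
        by (intro mult_left_mono) auto
      also have "\<dots> = (Q / c / 2) ^ (n + 1)"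
      proof -
        have "(32 * c) ^ (n + 1) = 16 ^ (n + 1) * (2 * c) ^ (n + 1)"
          unfolding power_mult_distrib[symmetric] by simp
        thus ?thesis using c by (simp only: \<kappa>_def power_divide) (simp add: field_simps power_mult_distrib)
      qed
      also have "\<dots> \<le> real M ^ (n + 1)" using M(2) Qc by (intro power_mono) auto
      finally have "real (2 * 16 ^ (n + 1) * L) \<le> real (M ^ (n + 1))" by simp
      thus ?thesis by (simp only: of_nat_le_iff)
    qed
    have height: "real (height_const n) * real M * real 1 ^ n \<le> Q"
      using M(1) c unfolding c_def[symmetric] by (simp add: field_simps)
    have res: "resultant_const n * real M ^ (2 * n) / real L \<le> \<rho> * Q powr (2 * real n - 2 * w)"
    proof -
      have "Q / c \<le> Q" using c Q1 by (simp add: divide_le_eq)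
      hence "real M ^ (2 * n) \<le> Q ^ (2 * n)" using M(1) by (intro power_mono) auto
      hence "resultant_const n * real M ^ (2 * n) / real L \<le> resultant_const n * Q ^ (2 * n) / (\<kappa> * z)"
        using L(1) \<open>\<kappa> * z > 0\<close> const_pos(2)[OF n] Q1
        by (intro frac_le mult_left_mono mult_nonneg_nonneg) auto
      also have "\<dots> = \<rho>0 * (Q powr real (2 * n) / Q powr (2 * w))"
        unfolding \<rho>0_def z_def using Q1 by (subst powr_realpow) simp_all
      also have "\<dots> = \<rho>0 * Q powr (2 * real n - 2 * w)" by (simp add: powr_diff)
      also have "\<dots> \<le> \<rho> * Q powr (2 * real n - 2 * w)" using \<rho> by (intro mult_right_mono) auto
      finally show ?thesis .
    qed
    let ?R = "real (card (resultant_pairs n \<rho> Q w))"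
    from resultant_pairs_count[OF n _ L(3) big height res]
    have "real M ^ (2 * n + 2) \<le> count_const n * real L * ?R" by simp
    also have "\<dots> \<le> count_const n * (2 * z) * ?R"
    proof (intro mult_right_mono mult_left_mono)
      have "\<kappa> * z \<le> 1 * z" using \<kappa>1 z(1) by (intro mult_right_mono) auto
      thus "real L \<le> 2 * z" using L(2) z(1) by linarith
    qed (use const_pos(3)[of n] in auto)
    finally have up: "real M ^ (2 * n + 2) \<le> count_const n * 2 * z * ?R" by simp
    have "(Q / c / 2) ^ (2 * n + 2) \<le> real M ^ (2 * n + 2)" using M(2) Qc by (intro power_mono) auto
    with up have low: "(Q / c / 2) ^ (2 * n + 2) \<le> count_const n * 2 * z * ?R" by linarith
    have "C * Q powr (2 * real n + 2 - 2 * w) = C * (Q powr real (2 * n + 2) / Q powr (2 * w))"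
      by (simp add: powr_diff add.commute)
    also have "\<dots> = C * (Q ^ (2 * n + 2) / z)" unfolding z_def using Q1 by (subst powr_realpow) auto
    also have "\<dots> = (Q / c / 2) ^ (2 * n + 2) / (count_const n * 2 * z)"
    proof -
      have "(Q / c / 2) ^ (2 * n + 2) = Q ^ (2 * n + 2) / (2 * c) ^ (2 * n + 2)"
        by (simp only: divide_divide_eq_left power_divide mult.commute)
      thus ?thesis by (simp only: C_def) (simp add: mult_ac)
    qed
    also have "\<dots> \<le> ?R"
    proof -
      have "count_const n * 2 * z > 0" using const_pos(3)[of n] z(1) by simp
      thus ?thesis using low by (simp only: pos_divide_le_eq) (simp only: mult_ac)
    qed
    finally show ?thesis .
  qed
  moreover have "\<rho>0 > 0" using const_pos(2)[OF n] \<kappa> by (simp add: \<rho>0_def)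
  moreover have "C > 0" using c const_pos(3)[of n] by (simp add: C_def)
  moreover have "1 / \<kappa> > 0" using \<kappa>(1) by simp
  hence "Q0 > 1" unfolding Q0_def by linarith
  ultimately show ?thesis by blast
qed

text \<open>
  Here \<open>L\<close> is as large as the pigeonhole principle permits, and \<open>T\<close> is determined by equating
  \<open>(Q / T ^ n) ^ (n - 1)\<close> with \<open>Q powr (2 * n - 2 * w)\<close>. The bound \<open>w \<le> n\<close> gives \<open>T ^ n \<le> Q\<close> up to a
  constant, so that \<open>M\<close> can be kept above any prescribed bound by taking \<open>\<eta>\<close> small and \<open>Q0\<close> large.
\<close>

lemma large_w_count:
  assumes n: "n \<ge> 1"
  shows "\<exists>\<rho>0>0. \<exists>C>0. \<exists>Q0>1. \<forall>\<rho>\<ge>\<rho>0. \<forall>Q\<ge>Q0. \<forall>w. (real n + 1) / 2 \<le> w \<and> w \<le> real n \<longrightarrow>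
    C * Q powr (2 * real n + 2 - 2 * w - 2 / real n * (2 * w - real n - 1)) \<le>
      real (card (resultant_pairs n \<rho> Q w))"
proof -
  define c where "c = real (height_const n)"
  define \<eta> where "\<eta> = 1 / (128 * c)"
  define q :: nat where "q = 2 * 16 ^ (n + 1)"
  define \<rho>0 where "\<rho>0 = resultant_const n * (2 * real q) * (1 / \<eta> ^ n) ^ (n - 1)"
  define C where "C = \<eta> ^ 2 * (1 / (2 * c * 2 ^ n)) ^ (n + 1) / count_const n"
  define Q0 where "Q0 = 64 * c"
  have c: "c \<ge> 1" unfolding c_def using const_pos(1)[of n] by linarith
  have \<eta>: "\<eta> > 0" "\<eta> \<le> 1" "(2 * \<eta>) * (64 * c) = 1" using c by (simp_all add: \<eta>_def)
  have q0: "q > 0" by (simp add: q_def)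
  have "C * Q powr (2 * real n + 2 - 2 * w - 2 / real n * (2 * w - real n - 1)) \<le>
      real (card (resultant_pairs n \<rho> Q w))"
    if \<rho>: "\<rho> \<ge> \<rho>0" and Q: "Q \<ge> Q0" and w: "(real n + 1) / 2 \<le> w" "w \<le> real n" for \<rho> Q w
  proof -
    have Q64: "Q \<ge> 64 * c" "Q > 1" using Q c by (simp_all add: Q0_def)
    \<comment> \<open>For \<open>n = 1\<close> both numerator and denominator vanish; the value 0 that division by 0 then gives is
      the right one, since then \<open>w = 1\<close> and \<open>T\<close> may stay bounded.\<close>
    define d where "d = 2 * (2 * w - real n - 1) / (real n * (real n - 1))"
    have d: "d * real n * (real n - 1) = 2 * (2 * w - real n - 1)"
    proof (cases "n = 1")
      case True
      thus ?thesis using w by simp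
    next
      case False
      hence "real n * (real n - 1) \<noteq> 0" using n by simp
      thus ?thesis unfolding d_def by (simp add: field_simps)
    qed
    have d0: "d \<ge> 0" using w n unfolding d_def by (intro divide_nonneg_nonneg mult_nonneg_nonneg) auto
    have dn: "real n * d \<le> 2"
    proof (cases "n = 1")
      case True
      thus ?thesis by (simp add: d_def)
    next
      case False
      hence n1: "real n - 1 > 0" using n by simp
      have "(real n * d) * (real n - 1) \<le> 2 * (real n - 1)" using d w by (simp add: mult_ac)
      thus ?thesis using n1 by (simp only: mult_le_cancel_right_pos)
    qed
    define y where "y = Q powr (d / 2)"
    have y1: "y \<ge> 1" unfolding y_def using Q64 d0 by (intro ge_one_powr_ge_zero) auto
    have yn: "y ^ n = Q powr (real n * d / 2)"
      using Q64 by (simp add: y_def powr_realpow[symmetric] powr_powr mult.commute)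
    have ynQ: "y ^ n \<le> Q"
    proof -
      have "y ^ n \<le> Q powr 1" unfolding yn using Q64 dn by (intro powr_mono) auto
      thus ?thesis using Q64 by simp
    qed
    define T where "T = nat \<lceil>\<eta> * y\<rceil>"
    have ey: "\<eta> * y > 0" using \<eta> y1 by simp
    note T = real_ceiling_bounds[OF ey, folded T_def]
    have "\<eta> * y \<le> 1 * y" using \<eta> y1 by (intro mult_right_mono) auto
    hence T2: "real T \<le> 2 * y" using T(2) y1 by linarith
    \<comment> \<open>Rounding up spoils the estimate when \<open>\<eta> * y \<le> 1\<close>; then \<open>T = 1\<close> and \<open>Q0\<close> takes care of it.\<close>
    have Tn: "64 * c * real T ^ n \<le> Q"
    proof (cases "\<eta> * y \<le> 1")
      case True
      hence "\<lceil>\<eta> * y\<rceil> \<le> 1" by (simp add: ceiling_le_one)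
      hence "T = 1" using T(3) unfolding T_def by linarith
      thus ?thesis using Q64 by simp
    next
      case False
      have e1: "2 * \<eta> \<le> 1" using c by (simp add: \<eta>_def)
      have "real T \<le> (2 * \<eta>) * y" using T(2) False by linarith
      hence "real T ^ n \<le> ((2 * \<eta>) * y) ^ n" by (intro power_mono) auto
      also have "\<dots> = (2 * \<eta>) ^ n * y ^ n" by (rule power_mult_distrib)
      also have "\<dots> \<le> (2 * \<eta>) ^ 1 * Q"
        using \<eta> e1 ynQ n y1 by (intro mult_mono power_decreasing) auto
      finally have "64 * c * real T ^ n \<le> 64 * c * ((2 * \<eta>) * Q)" using c by (intro mult_left_mono) auto
      also have "\<dots> = ((2 * \<eta>) * (64 * c)) * Q" by (simp only: mult_ac)
      also have "\<dots> = Q" by (simp only: \<eta>(3) mult_1)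
      finally show ?thesis .
    qed
    have T0: "real T ^ n > 0" using T(3) by simp
    have Qx: "64 \<le> Q / (c * real T ^ n)"
      using Tn c T0 by (simp add: pos_le_divide_eq mult_ac)
    define M where "M = nat \<lfloor>Q / (c * real T ^ n)\<rfloor>"
    have "1 \<le> Q / (c * real T ^ n)" using Qx by linarith
    note M = real_floor_ge_half[OF this, folded M_def]
    have "32 \<le> x / 2" if "64 \<le> x" for x :: real using that by simp
    from order_trans[OF this[OF Qx] M(2)] have "real M \<ge> 32" .
    hence M32: "M \<ge> 32" by simp
    define L where "L = M ^ (n + 1) div q"
    have big: "2 * 16 ^ (n + 1) * L \<le> M ^ (n + 1)" unfolding L_def q_def by simp
    have qM: "q \<le> M ^ (n + 1)"
    proof -
      have "q \<le> 2 ^ (n + 1) * 16 ^ (n + 1)" unfolding q_def by simp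
      also have "\<dots> = 32 ^ (n + 1)" by (simp only: power_mult_distrib[symmetric]) simp
      also have "\<dots> \<le> M ^ (n + 1)" using M32 by (intro power_mono) auto
      finally show ?thesis .
    qed
    hence L1: "L \<ge> 1" unfolding L_def using q0 by (simp add: Suc_le_eq div_greater_zero_iff)
    have upper: "M ^ (n + 1) \<le> 2 * q * L"
    proof -
      have "M ^ (n + 1) = q * L + M ^ (n + 1) mod q" unfolding L_def by simp
      also have "\<dots> \<le> q * L + q * L"
        using mult_le_mono2[OF L1, of q] mod_less_divisor[OF q0, of "M ^ (n + 1)"] by linarith
      finally show ?thesis by simp
    qed
    have height: "real (height_const n) * real M * real T ^ n \<le> Q"
      using M(1) c T0 unfolding c_def[symmetric] by (simp add: pos_le_divide_eq mult_ac)
    let ?e = "1 - real n * d / 2"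
    have Qe: "Q / y ^ n = Q powr ?e" unfolding yn using Q64 by (simp add: powr_diff)
    have Qe_pow: "(Q / y ^ n) ^ k = Q powr (real k * ?e)" for k
      unfolding Qe using Q64 by (simp add: powr_realpow[symmetric] powr_powr mult.commute)
    have res: "resultant_const n * real M ^ (2 * n) / real L \<le> \<rho> * Q powr (2 * real n - 2 * w)"
    proof -
      have "real (M ^ (n + 1)) \<le> real (2 * q * L)" using upper by (simp only: of_nat_le_iff)
      hence "real M ^ (n + 1) \<le> 2 * real q * real L" by simp
      moreover have "2 * n = (n - 1) + (n + 1)" using n by simp
      hence "real M ^ (2 * n) = real M ^ (n - 1) * real M ^ (n + 1)" by (simp only: power_add)
      ultimately have "real M ^ (2 * n) \<le> real M ^ (n - 1) * (2 * real q * real L)"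
        by (simp only:) (intro mult_left_mono, auto)
      hence "resultant_const n * real M ^ (2 * n) \<le> resultant_const n * (real M ^ (n - 1) * (2 * real q * real L))"
        using const_pos(2)[OF n] by (intro mult_left_mono) auto
      hence bd: "resultant_const n * real M ^ (2 * n) / real L \<le> resultant_const n * (2 * real q) * real M ^ (n - 1)"
        using L1 by (simp add: pos_divide_le_eq mult_ac)
      have "real M ^ (n - 1) \<le> ((1 / \<eta> ^ n) * (Q / y ^ n)) ^ (n - 1)"
      proof (intro power_mono)
        have "(\<eta> * y) ^ n \<le> real T ^ n" using T(1) ey by (intro power_mono) auto
        also have "\<dots> \<le> c * real T ^ n" using c T0 by simp
        finally have "Q / (c * real T ^ n) \<le> Q / (\<eta> * y) ^ n"
          using Q64 ey c T0 by (intro divide_left_mono) auto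
        thus "real M \<le> (1 / \<eta> ^ n) * (Q / y ^ n)" using M(1) by (simp add: power_mult_distrib)
      qed simp
      also have "((1 / \<eta> ^ n) * (Q / y ^ n)) ^ (n - 1) = (1 / \<eta> ^ n) ^ (n - 1) * Q powr (real (n - 1) * ?e)"
        by (simp only: power_mult_distrib Qe_pow)
      also have "real (n - 1) * ?e = (real n - 1) - (d * real n * (real n - 1)) / 2"
        using n by (simp add: of_nat_diff field_simps)
      also have "\<dots> = 2 * real n - 2 * w" unfolding d by (simp add: field_simps)
      finally have Mup: "real M ^ (n - 1) \<le> (1 / \<eta> ^ n) ^ (n - 1) * Q powr (2 * real n - 2 * w)" .
      note bd
      also have "resultant_const n * (2 * real q) * real M ^ (n - 1) \<le>
          resultant_const n * (2 * real q) * ((1 / \<eta> ^ n) ^ (n - 1) * Q powr (2 * real n - 2 * w))"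
        using const_pos(2)[OF n] by (intro mult_left_mono Mup) auto
      also have "\<dots> = \<rho>0 * Q powr (2 * real n - 2 * w)" by (simp only: \<rho>0_def mult.assoc)
      also have "\<dots> \<le> \<rho> * Q powr (2 * real n - 2 * w)" using \<rho> by (intro mult_right_mono) auto
      finally show ?thesis .
    qed
    let ?R = "real (card (resultant_pairs n \<rho> Q w))"
    have "real L \<le> real M ^ (n + 1)"
    proof -
      have "L \<le> M ^ (n + 1)" unfolding L_def by (rule div_le_dividend)
      hence "real L \<le> real (M ^ (n + 1))" by (simp only: of_nat_le_iff)
      thus ?thesis by simp
    qed
    hence "real T ^ 2 * real M ^ (n + 1) * real L \<le> real T ^ 2 * real M ^ (n + 1) * real M ^ (n + 1)"
      by (intro mult_left_mono) auto
    also have "\<dots> = real T ^ 2 * real M ^ (2 * n + 2)" by (simp add: mult.assoc mult_2 flip: power_add)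
    also have "\<dots> \<le> count_const n * real L * ?R"
      by (rule resultant_pairs_count[OF n T(3) L1 big height res])
    finally have "(real T ^ 2 * real M ^ (n + 1)) * real L \<le> (count_const n * ?R) * real L" by (simp add: mult_ac)
    hence low: "real T ^ 2 * real M ^ (n + 1) \<le> count_const n * ?R" using L1 by simp
    have Tlow: "(\<eta> * y) ^ 2 \<le> real T ^ 2" using T(1) ey by (intro power_mono) auto
    have base0: "0 \<le> (1 / (2 * c * 2 ^ n)) * (Q / y ^ n)" using c Q64 y1 by simp
    have Mlow: "((1 / (2 * c * 2 ^ n)) * (Q / y ^ n)) ^ (n + 1) \<le> real M ^ (n + 1)"
    proof (intro power_mono)
      have "real T ^ n \<le> (2 * y) ^ n" using T2 by (intro power_mono) auto
      hence "c * real T ^ n \<le> c * (2 * y) ^ n" using c by (intro mult_left_mono) auto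
      hence "Q / (c * (2 * y) ^ n) \<le> Q / (c * real T ^ n)"
        using Q64 c T0 y1 by (intro divide_left_mono) auto
      also have "\<dots> / 2 \<le> real M" by (rule M(2))
      finally have "Q / (c * (2 * y) ^ n) / 2 \<le> real M" by simp
      thus "(1 / (2 * c * 2 ^ n)) * (Q / y ^ n) \<le> real M" by (simp add: power_mult_distrib mult_ac)
    qed (rule base0)
    have "(\<eta> * y) ^ 2 * ((1 / (2 * c * 2 ^ n)) * (Q / y ^ n)) ^ (n + 1) \<le> real T ^ 2 * real M ^ (n + 1)"
      by (rule mult_mono[OF Tlow Mlow _ zero_le_power[OF base0]]) simp
    with low have fin: "(\<eta> * y) ^ 2 * ((1 / (2 * c * 2 ^ n)) * (Q / y ^ n)) ^ (n + 1) \<le> count_const n * ?R"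
      by linarith
    have "2 / real n * (2 * w - real n - 1) = d * (real n - 1)"
    proof -
      have "2 / real n * (2 * w - real n - 1) = (d * real n * (real n - 1)) / real n" unfolding d by simp
      thus ?thesis using n by simp
    qed
    moreover have "d + real (n + 1) * ?e = real n + 1 - (d * real n * (real n - 1)) / 2 - d * (real n - 1)"
      by (simp add: field_simps)
    ultimately have expo: "2 * real n + 2 - 2 * w - 2 / real n * (2 * w - real n - 1) = d + real (n + 1) * ?e"
      unfolding d by (simp only:) (simp add: diff_divide_distrib)
    have y2: "y ^ 2 = Q powr d" using Q64 by (simp add: y_def powr_realpow[symmetric] powr_powr)
    have "C * Q powr (2 * real n + 2 - 2 * w - 2 / real n * (2 * w - real n - 1)) =
        C * (Q powr d * Q powr (real (n + 1) * ?e))"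
      unfolding expo powr_add ..
    also have "\<dots> = (\<eta> * y) ^ 2 * ((1 / (2 * c * 2 ^ n)) * (Q / y ^ n)) ^ (n + 1) / count_const n"
      by (simp only: C_def power_mult_distrib y2 Qe_pow) (simp only: mult_ac times_divide_eq_right times_divide_eq_left)
    also have "\<dots> \<le> ?R"
      using fin const_pos(3)[of n] by (simp only: pos_divide_le_eq) (simp only: mult_ac)
    finally show ?thesis .
  qed
  moreover have "\<rho>0 > 0" using const_pos(2)[OF n] \<eta> q0 by (simp add: \<rho>0_def)
  moreover have "C > 0" using c \<eta> const_pos(3)[of n] by (simp add: C_def)
  moreover have "Q0 > 1" using c by (simp add: Q0_def)
  ultimately show ?thesis by blast
qed

theorem theorem2:
  fixes n :: nat
  assumes "n \<ge> 1"
  shows "\<exists>\<rho>>0. \<exists>C>0. \<exists>Q0>1. \<forall>Q\<ge>Q0. \<forall>w::real.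
     (0 \<le> w \<and> w \<le> (real n + 1) / 2 \<longrightarrow>
        real (card (resultant_pairs n \<rho> Q w)) \<ge> C * Q powr (2 * real n + 2 - 2 * w)) \<and>
     ((real n + 1) / 2 \<le> w \<and> w \<le> real n \<longrightarrow>
        real (card (resultant_pairs n \<rho> Q w)) \<ge>
          C * Q powr (2 * real n + 2 - 2 * w - 2 / real n * (2 * w - real n - 1)))"
proof -
  obtain \<rho>1 C1 Q1 where 1: "\<rho>1 > 0" "C1 > 0" "Q1 > 1"
    "\<And>\<rho> Q w. \<rho> \<ge> \<rho>1 \<Longrightarrow> Q \<ge> Q1 \<Longrightarrow> 0 \<le> w \<Longrightarrow> w \<le> (real n + 1) / 2 \<Longrightarrow>
      C1 * Q powr (2 * real n + 2 - 2 * w) \<le> real (card (resultant_pairs n \<rho> Q w))"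
    using small_w_count[OF assms] by metis
  obtain \<rho>2 C2 Q2 where 2: "\<rho>2 > 0" "C2 > 0" "Q2 > 1"
    "\<And>\<rho> Q w. \<rho> \<ge> \<rho>2 \<Longrightarrow> Q \<ge> Q2 \<Longrightarrow> (real n + 1) / 2 \<le> w \<Longrightarrow> w \<le> real n \<Longrightarrow>
      C2 * Q powr (2 * real n + 2 - 2 * w - 2 / real n * (2 * w - real n - 1)) \<le>
        real (card (resultant_pairs n \<rho> Q w))"
    using large_w_count[OF assms] by metis
  let ?C = "min C1 C2"
  have C: "?C * Q powr e \<le> C1 * Q powr e" "?C * Q powr e \<le> C2 * Q powr e" for Q e :: real
    by (simp_all add: mult_right_mono)
  have "(0 \<le> w \<and> w \<le> (real n + 1) / 2 \<longrightarrow>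
        real (card (resultant_pairs n (max \<rho>1 \<rho>2) Q w)) \<ge> ?C * Q powr (2 * real n + 2 - 2 * w)) \<and>
     ((real n + 1) / 2 \<le> w \<and> w \<le> real n \<longrightarrow>
        real (card (resultant_pairs n (max \<rho>1 \<rho>2) Q w)) \<ge>
          ?C * Q powr (2 * real n + 2 - 2 * w - 2 / real n * (2 * w - real n - 1)))"
    if Q: "Q \<ge> max Q1 Q2" for Q w :: real
  proof (intro conjI impI)
    assume "0 \<le> w \<and> w \<le> (real n + 1) / 2"
    with Q have "C1 * Q powr (2 * real n + 2 - 2 * w) \<le> real (card (resultant_pairs n (max \<rho>1 \<rho>2) Q w))"
      by (intro 1(4)) auto
    with C(1) show "?C * Q powr (2 * real n + 2 - 2 * w) \<le>
        real (card (resultant_pairs n (max \<rho>1 \<rho>2) Q w))" by (rule order_trans)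
  next
    assume "(real n + 1) / 2 \<le> w \<and> w \<le> real n"
    with Q have "C2 * Q powr (2 * real n + 2 - 2 * w - 2 / real n * (2 * w - real n - 1)) \<le>
        real (card (resultant_pairs n (max \<rho>1 \<rho>2) Q w))"
      by (intro 2(4)) auto
    with C(2) show "?C * Q powr (2 * real n + 2 - 2 * w - 2 / real n * (2 * w - real n - 1)) \<le>
        real (card (resultant_pairs n (max \<rho>1 \<rho>2) Q w))" by (rule order_trans)
  qed
  moreover have "max \<rho>1 \<rho>2 > 0" "?C > 0" "max Q1 Q2 > 1" using 1 2 by auto
  ultimately show ?thesis by blast
qed

end
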